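(* Let $0<q<1$ and assume that the following conditions hold: (C1) there exist $K_1>0$ and $r\in(q,1)$ such that $\epsilon(t)\ge\frac{K_1}{t^{r+q}}$ for $t$ big enough; (C2) if $\gamma\neq0$ then $\epsilon(t)\le\frac{\alpha}{2\gamma t^q}$ for $t$ big enough; (C3) there exists $K_3>0$ such that $\left(\frac{\dot{\epsilon}(t)}{\epsilon(t)}\right)^2\le\frac{K_3}{t^2}$ for $t$ big enough. Let $u_0,v_0\in\mathcal{H}$ and let $x:[t_0,+\infty[\to\mathcal{H}$ be the unique global solution of the system (DS) described in the context. Then, with $r$ as in (C1): (i) $x(t)$ converges strongly, as $t\to+\infty$, to $x^*$, the element of minimum norm of $\operatorname{argmin} g$. (ii) As $t\to+\infty$, $$g_t(x(t)+\beta(t)\dot{x}(t))-g_t(x_t)=\mathcal{O}\big(t^{2r-2q-2}+\epsilon(t)t^{r-1}\big),$$ $$g(x(t)+\beta(t)\dot{x}(t))-\min g=\mathcal{O}\big(t^{2r-2q-2}+\epsilon(t)\big),$$ $$\|\dot{x}(t)\|=\mathcal{O}\big(t^{r-q-1}+\sqrt{\epsilon(t)}\,t^{\frac{r-1}{2}}\big),\qquad \|x(t)-x_t\|=\mathcal{O}\big(t^{r-1}+\sqrt{\epsilon(t)}\,t^{\frac{2q+r-1}{2}}\big).$$ (iii) If $t^{2q-1}\epsilon(t)\in L^1[t_0,+\infty[$, then $$\int_{t_0}^{+\infty}t^q\big(g_t(x(t)+\beta(t)\dot{x}(t))-g_t(x_t)\big)dt<+\infty,\qquad \int_{t_0}^{+\infty}t^q\|\dot{x}(t)\|^2dt<+\infty,$$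 and, moreover, $\int_{t_0}^{+\infty}t^{2q}\|\nabla g(x(t)+\beta(t)\dot{x}(t))+\epsilon(t)x(t)\|^2dt<+\infty$ if $\gamma>0$, and $\int_{t_0}^{+\infty}t^{2q-1}\|\nabla g(x(t)+\beta(t)\dot{x}(t))\|^2dt<+\infty$ if $\gamma=0$.
   Context: $\mathcal{H}$ is a real Hilbert space with scalar product $\langle\cdot,\cdot\rangle$ and norm $\|\cdot\|$. The function $g:\mathcal{H}\to\mathbb{R}$ is convex and Fréchet differentiable, $\nabla g$ is Lipschitz continuous on bounded sets, and $\operatorname{argmin} g\neq\emptyset$. Parameters: $t_0>0$, $\alpha>0$, $0<q<1$, and either ($\gamma>0$ and $\beta\in\mathbb{R}$) or ($\gamma=0$ and $\beta>0$); if $\beta<0$ then also $t_0>\left|\frac{\beta}{\gamma}\right|^{1/q}$. Notation: $\beta(t)=\gamma+\frac{\beta}{t^q}$ (so $\beta(t)>0$ on $[t_0,+\infty[$). The function $\epsilon:[t_0,+\infty[\to\mathbb{R}_+$ is non-increasing, of class $C^1$, with $\lim_{t\to+\infty}\epsilon(t)=0$. The system (DS) is $$\ddot{x}(t)+\frac{\alpha}{t^q}\dot{x}(t)+\nabla g\big(x(t)+\beta(t)\dot{x}(t)\big)+\epsilon(t)x(t)=0,\qquad x(t_0)=u_0,\ \dot{x}(t_0)=v_0;$$ it has a unique global solution on $[t_0,+\infty[$ for all $u_0,v_0\in\mathcal{H}$. For $t\ge t_0$, $g_t:\mathcal{H}\to\mathbb{R}$ is the strongly convex function $g_t(x)=g(x)+\frac{\epsilon(t)}{2}\|x\|^2$,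 and $x_t$ denotes its unique minimizer over $\mathcal{H}$. *)

theory Defs
  imports "HOL-Analysis.Analysis" "HOL-Library.Landau_Symbols"
begin

definition argmin_set :: "('a \<Rightarrow> real) \<Rightarrow> 'a set" where
  "argmin_set f = {x. \<forall>y. f x \<le> f y}"

definition the_minimizer :: "('a \<Rightarrow> real) \<Rightarrow> 'a" where
  "the_minimizer f = (THE x. x \<in> argmin_set f)"

definition min_norm_element :: "'a::real_normed_vector set \<Rightarrow> 'a" where
  "min_norm_element S = (THE z. z \<in> S \<and> (\<forall>y\<in>S. norm z \<le> norm y))"

definition tikhonov :: "('a::real_normed_vector \<Rightarrow> real) \<Rightarrow> real \<Rightarrow> 'a \<Rightarrow> real" where
  "tikhonov g e x = g x + e / 2 * (norm x)\<^sup>2"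

definition beta_coeff :: "real \<Rightarrow> real \<Rightarrow> real \<Rightarrow> real \<Rightarrow> real" where
  "beta_coeff \<gamma> \<beta> q t = \<gamma> + \<beta> / t powr q"

text \<open>\<^term>\<open>DS_solution\<close>: \<open>x\<close> is a twice differentiable global solution with velocity \<open>v\<close>;
  \<open>G\<close> stands for the gradient of the objective.  Derivatives at the left endpoint \<open>t0\<close> are
  one-sided.  Only the values on \<open>{t0..}\<close> matter.\<close>
definition DS_solution ::
  "('a::real_normed_vector \<Rightarrow> 'a) \<Rightarrow> (real \<Rightarrow> real) \<Rightarrow> real \<Rightarrow> real \<Rightarrow> real \<Rightarrow> real \<Rightarrow> real
    \<Rightarrow> 'a \<Rightarrow> 'a \<Rightarrow> (real \<Rightarrow> 'a) \<Rightarrow> (real \<Rightarrow> 'a) \<Rightarrow> bool" where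
  "DS_solution G \<epsilon> \<alpha> \<beta> \<gamma> q t0 u0 v0 x v \<longleftrightarrow>
     x t0 = u0 \<and> v t0 = v0 \<and>
     (\<exists>a. \<forall>t\<ge>t0.
        (x has_vector_derivative v t) (at t within {t0..}) \<and>
        (v has_vector_derivative a t) (at t within {t0..}) \<and>
        a t + (\<alpha> / t powr q) *\<^sub>R v t + G (x t + beta_coeff \<gamma> \<beta> q t *\<^sub>R v t) + \<epsilon> t *\<^sub>R x t = 0)"

end

theory Submission
  imports Defs "HOL-Real_Asymp.Real_Asymp"
begin

text \<open>
  Put $T = t^q$, $p = x - x_t$, $A = \nabla g(y) + \epsilon x$ and $D = g_t(y) - g_t(x_t)$.  The energy
  $E = T^2 D + \frac12 \|\frac\alpha4 p + T \dot x\|^2 + \frac{3\alpha^2}{32} \|p\|^2$ dissipates: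
  up to constants, $E' \le - (T D + \epsilon T \|p\|^2 + T \|\dot x\|^2 + \beta(t) T^2 \|A\|^2) + C R$ with
  $R = \epsilon t^{2q-1} + t^{r-2}$, and by (C1) the dissipated quantity dominates $t^{-r} E$.
  Because $R$ varies only polynomially (C3) whereas $t^{-r}$ with $r < 1$ beats $1/t$, a large multiple of
  $t^r R$ is a barrier for $E$.  This gives the rates; integrating the inequality gives the integral
  estimates.  Strong convergence follows by bounding $\|x - x_t\|$ through $E$ if
  $\epsilon \le t^{-2q}$, and through $\frac\epsilon2 \|y - x_t\|^2 \le D$ otherwise.

  As $t \mapsto x_t$ is only locally Lipschitz, $E$ is not known to be differentiable, and $E'$ is
  replaced by an upper right Dini derivative.
\<close>

section \<open>Minimizers of the Tikhonov regularization\<close>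

text \<open>The weights in the energy are dictated by cancellations. The factor T turns the damping
  \<alpha>/T into the constant \<alpha>: with x_t frozen, (\<alpha>/4) p + T v has derivative
  (\<alpha>/4 - \<alpha> + q T/t) v - T A. Half its square therefore produces
  (\<alpha>/4)(\<alpha>/4 - \<alpha>) <p,v>, and the coefficient of |p|^2 in the energy is the one
  whose derivative removes exactly this term. The same square produces - T^2 <v,A>, which cancels
  the leading part of the derivative of T^2 D, and - (\<alpha>/4) T <p,A>, from which strong
  convexity of g_t extracts the decay of D and of |p|^2.

  One term of bad sign has the order of the dissipation itself: \<epsilon> \<beta>(t) T^2 |v|^2,
  against - (3/4) \<alpha> T |v|^2. It is absorbed because \<epsilon> \<beta>(t) T is asymptotically
  at most \<alpha>/2, by (C2) if \<gamma> > 0 and because \<epsilon> tends to 0 if \<gamma> =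
  0.\<close>

locale convex_gradient =
  fixes g :: "'a::{real_inner, complete_space} \<Rightarrow> real" and G :: "'a \<Rightarrow> 'a"
  assumes g_convex: "convex_on UNIV g"
    and g_gradient: "\<And>z. GDERIV g z :> G z"
    and argmin_nonempty: "argmin_set g \<noteq> {}"
begin

abbreviation x_min :: "real \<Rightarrow> 'a" where
  "x_min e \<equiv> the_minimizer (tikhonov g e)"

lemma g_continuous: "continuous_on S g"
  using g_gradient unfolding gderiv_def
  by (meson continuous_at_imp_continuous_on has_derivative_continuous)

text \<open>On the line through \<open>w\<close> and \<open>z\<close> this is the tangent inequality
  for a convex function of one variable.\<close>

lemma gradient_inequality: "g w + G w \<bullet> (z - w) \<le> g z"
proof -
  define \<phi> where "\<phi> = (\<lambda>\<tau>::real. g (w + \<tau> *\<^sub>R (z - w)))"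
  have cv: "convex_on UNIV \<phi>"
  proof (rule convex_onI)
    fix t a b :: real assume t: "0 < t" "t < 1"
    have "w + ((1 - t) * a + t * b) *\<^sub>R (z - w)
        = (1 - t) *\<^sub>R (w + a *\<^sub>R (z - w)) + t *\<^sub>R (w + b *\<^sub>R (z - w))"
      by (simp add: algebra_simps)
    then show "\<phi> ((1 - t) *\<^sub>R a + t *\<^sub>R b) \<le> (1 - t) * \<phi> a + t * \<phi> b"
      using convex_onD[OF g_convex, of t "w + a *\<^sub>R (z - w)" "w + b *\<^sub>R (z - w)"] t
      by (simp add: \<phi>_def)
  qed simp
  have "((\<lambda>\<tau>::real. w + \<tau> *\<^sub>R (z - w)) has_derivative (\<lambda>\<tau>. \<tau> *\<^sub>R (z - w))) (at 0)"
    by (auto intro!: derivative_eq_intros)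
  moreover have "(g has_derivative (\<lambda>h. h \<bullet> G w)) (at (w + (0::real) *\<^sub>R (z - w)))"
    using g_gradient[of w] by (simp add: gderiv_def)
  ultimately have "(\<phi> has_derivative (\<lambda>\<tau>. (\<tau> *\<^sub>R (z - w)) \<bullet> G w)) (at 0)"
    unfolding \<phi>_def by (rule has_derivative_compose)
  then have "(\<phi> has_field_derivative ((z - w) \<bullet> G w)) (at 0)"
    unfolding has_field_derivative_def by (rule has_derivative_eq_rhs) (auto simp: fun_eq_iff)
  from convex_on_imp_above_tangent[OF cv connected_UNIV _ _ this, of 1]
  show ?thesis by (simp add: \<phi>_def inner_commute)
qed

text \<open>The parallelogram law makes the midpoint gain of the quadratic term exact. For
  \<open>e > 0\<close> two almost optimal points are therefore close to each other.\<close>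

lemma tikhonov_midpoint:
  "tikhonov g e ((1/2) *\<^sub>R (u + w)) \<le> (tikhonov g e u + tikhonov g e w) / 2 - e / 8 * (norm (u - w))\<^sup>2"
proof -
  have "g ((1/2) *\<^sub>R (u + w)) \<le> (g u + g w) / 2"
    using convex_onD[OF g_convex, of "1/2" u w] by (simp add: scaleR_add_right)
  moreover have "(norm ((1/2) *\<^sub>R (u + w)))\<^sup>2 = ((norm u)\<^sup>2 + (norm w)\<^sup>2) / 2 - (norm (u - w))\<^sup>2 / 4"
    unfolding power2_norm_eq_inner
    by (simp add: inner_add_left inner_add_right inner_diff_left inner_diff_right inner_commute field_simps)
  ultimately show ?thesis
    unfolding tikhonov_def by (simp only:) (simp add: field_simps)
qed

text \<open>Bounded closed sets need not be compact here, so existence rests on completeness: a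
  minimizing sequence is Cauchy by \<open>tikhonov_midpoint\<close>, since midpoints cannot go below
  the infimum.\<close>

lemma minimizer_exists:
  assumes e: "e > 0" shows "argmin_set (tikhonov g e) \<noteq> {}"
proof -
  define h where "h = tikhonov g e"
  obtain z0 where z0: "\<And>y. g z0 \<le> g y" using argmin_nonempty by (auto simp: argmin_set_def)
  have bdd: "bdd_below (range h)"
    using z0 e by (intro bdd_belowI[of _ "g z0"]) (auto simp: h_def tikhonov_def intro: add_increasing2)
  define m where "m = (INF z. h z)"
  have m: "m \<le> h z" for z unfolding m_def by (rule cINF_lower[OF bdd]) simp
  have "\<exists>u. h u < m + inverse (real (Suc n))" for n
    using cINF_less_iff[OF _ bdd, of "m + inverse (real (Suc n))"] by (auto simp: m_def)
  then obtain u where u: "\<And>n. h (u n) < m + inverse (real (Suc n))" by metis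
  have dist: "(norm (u j - u k))\<^sup>2 \<le> 8 / e * inverse (real (Suc N))" if "j \<ge> N" "k \<ge> N" for j k N
  proof -
    have "inverse (real (Suc j)) \<le> inverse (real (Suc N))" "inverse (real (Suc k)) \<le> inverse (real (Suc N))"
      using that by (auto intro!: le_imp_inverse_le)
    then have "e / 8 * (norm (u j - u k))\<^sup>2 \<le> inverse (real (Suc N))"
      using tikhonov_midpoint[of e "u j" "u k"] m[of "(1/2) *\<^sub>R (u j + u k)"] u[of j] u[of k]
      unfolding h_def by argo
    then have "(norm (u j - u k))\<^sup>2 \<le> inverse (real (Suc N)) / (e / 8)"
      using e by (simp only: pos_le_divide_eq mult.commute)
    then show ?thesis by (simp add: field_simps)
  qed
  have "Cauchy u"
  proof (rule metric_CauchyI)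
    fix d :: real assume d: "d > 0"
    have "(\<lambda>N. 8 / e * inverse (real (Suc N))) \<longlonglongrightarrow> 8 / e * 0"
      by (intro tendsto_intros LIMSEQ_inverse_real_of_nat)
    then have "eventually (\<lambda>N. 8 / e * inverse (real (Suc N)) < d\<^sup>2) sequentially"
      using d by (intro order_tendstoD(2)[of _ 0]) auto
    then obtain N where N: "8 / e * inverse (real (Suc N)) < d\<^sup>2"
      by (auto simp: eventually_sequentially)
    have "dist (u j) (u k) < d" if "j \<ge> N" "k \<ge> N" for j k
      using dist[OF that] N d by (auto simp: dist_norm intro: power2_less_imp_less)
    then show "\<exists>N. \<forall>j\<ge>N. \<forall>k\<ge>N. dist (u j) (u k) < d" by blast
  qed
  then obtain l where l: "u \<longlonglongrightarrow> l" using Cauchy_convergent convergent_def by blast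
  have "isCont g l" using g_continuous[of UNIV] by (simp add: continuous_on_eq_continuous_at)
  then have "(\<lambda>n. h (u n)) \<longlonglongrightarrow> h l"
    unfolding h_def tikhonov_def by (intro tendsto_intros isCont_tendsto_compose[of l g] l)
  moreover have "(\<lambda>n. m + inverse (real (Suc n))) \<longlonglongrightarrow> m + 0"
    by (intro tendsto_intros LIMSEQ_inverse_real_of_nat)
  ultimately have "h l \<le> m + 0"
    using u by (intro LIMSEQ_le[of "\<lambda>n. h (u n)"]) (auto intro: less_imp_le)
  then have "l \<in> argmin_set h" using m by (auto simp: argmin_set_def intro: order_trans)
  then show ?thesis by (auto simp: h_def)
qed

text \<open>Stationarity gives \<open>G w = - (e *\<^sub>R w)\<close>; inserted into the gradient
  inequality it leaves exactly the completed square. Uniqueness, the dependence on \<open>e\<close>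
  and the control of \<open>y t - xt t\<close> by \<open>gap\<close> all come from this
  bound.\<close>

lemma minimizer_growth:
  assumes w: "w \<in> argmin_set (tikhonov g e)"
  shows "e / 2 * (norm (z - w))\<^sup>2 \<le> tikhonov g e z - tikhonov g e w"
proof -
  have "((\<lambda>u. tikhonov g e u) has_derivative (\<lambda>h. h \<bullet> (G w + e *\<^sub>R w))) (at w)"
    unfolding tikhonov_def power2_norm_eq_inner using g_gradient[of w]
    by (auto intro!: derivative_eq_intros simp: gderiv_def inner_add_right inner_commute algebra_simps)
  then have "(\<lambda>h. h \<bullet> (G w + e *\<^sub>R w)) = (\<lambda>h. 0)"
    using w by (intro differential_zero_maxmin[of w UNIV "tikhonov g e"]) (auto simp: argmin_set_def)
  \<comment> \<open>The vanishing derivative is evaluated in the direction of the gradient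
    itself.\<close>
  then have "(G w + e *\<^sub>R w) \<bullet> (G w + e *\<^sub>R w) = 0" by metis
  then have "G w = - (e *\<^sub>R w)" by (simp add: eq_neg_iff_add_eq_0)
  then have "g z \<ge> g w - e * (w \<bullet> (z - w))" using gradient_inequality[of w z] by simp
  moreover have "(norm z)\<^sup>2 = (norm w)\<^sup>2 + 2 * (w \<bullet> (z - w)) + (norm (z - w))\<^sup>2"
    unfolding power2_norm_eq_inner by (simp add: inner_diff_left inner_diff_right inner_commute)
  ultimately show ?thesis
    unfolding tikhonov_def by (simp only:) (simp add: field_simps)
qed

lemma x_min_argmin:
  assumes "e > 0" shows "x_min e \<in> argmin_set (tikhonov g e)"
proof -
  obtain w where w: "w \<in> argmin_set (tikhonov g e)" using minimizer_exists[OF assms] by blast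
  have "z = w" if "z \<in> argmin_set (tikhonov g e)" for z
  proof -
    have "e / 2 * (norm (z - w))\<^sup>2 \<le> 0"
      using minimizer_growth[OF w, of z] that by (auto simp: argmin_set_def intro: order_trans)
    then show ?thesis using assms by (simp add: mult_le_0_iff)
  qed
  then show ?thesis unfolding the_minimizer_def using w by (rule_tac theI2) auto
qed

lemma x_min_growth:
  "e > 0 \<Longrightarrow> e / 2 * (norm (z - x_min e))\<^sup>2 \<le> tikhonov g e z - tikhonov g e (x_min e)"
  by (intro minimizer_growth x_min_argmin)

lemma x_min_le: "e > 0 \<Longrightarrow> tikhonov g e (x_min e) \<le> tikhonov g e z"
  using x_min_argmin by (auto simp: argmin_set_def)

section \<open>The curve of Tikhonov minimizers and its limit\<close>

lemma norm_x_min_le: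
  assumes "e > 0" "z \<in> argmin_set g" shows "norm (x_min e) \<le> norm z"
proof -
  have "g z \<le> g (x_min e)" using assms by (auto simp: argmin_set_def)
  with x_min_le[OF assms(1), of z] have "e / 2 * (norm (x_min e))\<^sup>2 \<le> e / 2 * (norm z)\<^sup>2"
    by (simp add: tikhonov_def)
  then show ?thesis using assms(1) by (simp add: power_mono_iff)
qed

text \<open>Each minimizer is tested in the growth bound of the other; in the sum the values of
  \<open>g\<close> cancel. Monotonicity of the norm, the Lipschitz bound and the Cauchy property all
  follow from this.\<close>

lemma x_min_diff:
  assumes "d > 0" "e > 0"
  shows "(d + e) * (norm (x_min d - x_min e))\<^sup>2 \<le> (e - d) * ((norm (x_min d))\<^sup>2 - (norm (x_min e))\<^sup>2)"
  using x_min_growth[OF assms(1), of "x_min e"] x_min_growth[OF assms(2), of "x_min d"]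
  by (simp add: tikhonov_def norm_minus_commute[of "x_min e"] field_simps)

text \<open>The difference of squares in \<open>x_min_diff\<close> is an inner product of difference
  and sum, so one factor \<open>norm (x_min d - x_min e)\<close> cancels. Because of the denominator
  \<open>d + e\<close>, the speed of \<open>xt\<close> will be governed by the logarithmic
  derivative of \<epsilon>.\<close>

lemma x_min_lipschitz:
  assumes d: "d > 0" and e: "e > 0" and X: "z \<in> argmin_set g"
  shows "norm (x_min d - x_min e) \<le> 2 * norm z * \<bar>e - d\<bar> / (d + e)"
proof (cases "x_min d = x_min e")
  case True
  have "0 \<le> 2 * norm z * \<bar>e - d\<bar> / (d + e)" using d e by (auto intro!: divide_nonneg_nonneg mult_nonneg_nonneg)
  then show ?thesis unfolding True by simp
next
  case False
  let ?n = "norm (x_min d - x_min e)"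
  have "(norm (x_min d))\<^sup>2 - (norm (x_min e))\<^sup>2 = (x_min d - x_min e) \<bullet> (x_min d + x_min e)"
    unfolding power2_norm_eq_inner by (simp add: inner_add_right inner_diff_left inner_diff_right inner_commute)
  also have "\<bar>\<dots>\<bar> \<le> ?n * norm (x_min d + x_min e)" by (rule Cauchy_Schwarz_ineq2)
  also have "\<dots> \<le> ?n * (2 * norm z)"
    using norm_triangle_ineq[of "x_min d" "x_min e"] norm_x_min_le[OF d X] norm_x_min_le[OF e X]
    by (intro mult_left_mono) auto
  finally have "\<bar>(norm (x_min d))\<^sup>2 - (norm (x_min e))\<^sup>2\<bar> \<le> ?n * (2 * norm z)" .
  then have "\<bar>e - d\<bar> * \<bar>(norm (x_min d))\<^sup>2 - (norm (x_min e))\<^sup>2\<bar> \<le> \<bar>e - d\<bar> * (?n * (2 * norm z))"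
    by (intro mult_left_mono) auto
  then have "(d + e) * ?n\<^sup>2 \<le> \<bar>e - d\<bar> * (?n * (2 * norm z))"
    using x_min_diff[OF d e] abs_ge_self[of "(e - d) * ((norm (x_min d))\<^sup>2 - (norm (x_min e))\<^sup>2)"]
    unfolding abs_mult by linarith
  then have "?n * ((d + e) * ?n) \<le> ?n * (2 * norm z * \<bar>e - d\<bar>)"
    by (simp add: power2_eq_square mult_ac)
  then have "(d + e) * ?n \<le> 2 * norm z * \<bar>e - d\<bar>" using False by (simp add: mult_le_cancel_left)
  then show ?thesis using d e by (simp add: field_simps)
qed

text \<open>As the parameter decreases to 0, the norm of the minimizer increases and stays bounded,
  hence converges; \<open>x_min_diff\<close> turns convergence of the norms into strong convergence
  of the points, without passing through weak limits.\<close>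

lemma x_min_tendsto:
  obtains z where "z \<in> argmin_set g" "\<And>y. y \<in> argmin_set g \<Longrightarrow> norm z \<le> norm y"
    "(x_min \<longlongrightarrow> z) (at_right 0)"
proof -
  obtain z0 where z0: "z0 \<in> argmin_set g" using argmin_nonempty by blast
  let ?u = "\<lambda>n. x_min (inverse (real (Suc n)))"
  have mono: "norm (x_min e) \<le> norm (x_min d)" if "0 < d" "d \<le> e" for d e
  proof (cases "d = e")
    case False
    have "0 \<le> (d + e) * (norm (x_min d - x_min e))\<^sup>2" using that by simp
    also have "\<dots> \<le> (e - d) * ((norm (x_min d))\<^sup>2 - (norm (x_min e))\<^sup>2)"
      using x_min_diff[of d e] that by simp
    finally show ?thesis using False that by (simp add: zero_le_mult_iff)
  qed simp
  have close: "(norm (x_min d - x_min e))\<^sup>2 \<le> (norm (x_min d))\<^sup>2 - (norm (x_min e))\<^sup>2" if "0 < d" "d \<le> e" for d e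
  proof -
    have p: "0 \<le> (norm (x_min d))\<^sup>2 - (norm (x_min e))\<^sup>2" using mono[OF that] by simp
    have "(d + e) * (norm (x_min d - x_min e))\<^sup>2 \<le> (e - d) * ((norm (x_min d))\<^sup>2 - (norm (x_min e))\<^sup>2)"
      using x_min_diff[of d e] that by simp
    also have "\<dots> \<le> (d + e) * ((norm (x_min d))\<^sup>2 - (norm (x_min e))\<^sup>2)"
      using that p by (intro mult_right_mono) auto
    finally show ?thesis using that by simp
  qed
  \<comment> \<open>By monotonicity this supremum is the limit of the squared norms at 0.\<close>
  define s where "s = (SUP e\<in>{0<..}. (norm (x_min e))\<^sup>2)"
  have bdd: "bdd_above ((\<lambda>e. (norm (x_min e))\<^sup>2) ` {0<..})"
    using norm_x_min_le[OF _ z0] by (intro bdd_aboveI[of _ "(norm z0)\<^sup>2"]) auto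
  have le_s: "(norm (x_min e))\<^sup>2 \<le> s" if "e > 0" for e
    unfolding s_def using that by (intro cSUP_upper[OF _ bdd]) auto
  have near: "\<exists>e0>0. \<forall>e. 0 < e \<and> e \<le> e0 \<longrightarrow> s - \<eta> < (norm (x_min e))\<^sup>2" if "\<eta> > 0" for \<eta>
  proof -
    have "s - \<eta> < s" using that by simp
    then obtain e0 where "e0 > 0" "s - \<eta> < (norm (x_min e0))\<^sup>2"
      using less_cSUP_iff[OF _ bdd, of "s - \<eta>"] unfolding s_def by auto
    moreover have "(norm (x_min e0))\<^sup>2 \<le> (norm (x_min e))\<^sup>2" if "0 < e" "e \<le> e0" for e
      using mono[OF that] by simp
    ultimately show ?thesis by (intro exI[of _ e0]) (auto intro: less_le_trans)
  qed
  have cau: "\<exists>e0>0. \<forall>d e. 0 < d \<and> d \<le> e \<and> e \<le> e0 \<longrightarrow> dist (x_min d) (x_min e) < \<eta>" if \<eta>: "\<eta> > 0" for \<eta>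
  proof -
    obtain e0 where e0: "e0 > 0" "\<And>e. 0 < e \<Longrightarrow> e \<le> e0 \<Longrightarrow> s - \<eta>\<^sup>2 < (norm (x_min e))\<^sup>2"
      using near[of "\<eta>\<^sup>2"] \<eta> by auto
    have "dist (x_min d) (x_min e) < \<eta>" if "0 < d" "d \<le> e" "e \<le> e0" for d e
    proof -
      have "(norm (x_min d - x_min e))\<^sup>2 < \<eta>\<^sup>2"
        using close[OF that(1,2)] le_s[OF that(1)] e0(2)[of e] that by linarith
      then show ?thesis using \<eta> by (simp add: dist_norm power2_less_imp_less)
    qed
    then show ?thesis using e0 by blast
  qed
  have inv0: "eventually (\<lambda>n. inverse (real (Suc n)) \<le> e0) sequentially" if "e0 > 0" for e0
    using order_tendstoD(2)[OF LIMSEQ_inverse_real_of_nat that] by (rule eventually_mono) simp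
  have "Cauchy ?u"
  proof (rule metric_CauchyI)
    fix \<eta> :: real assume "\<eta> > 0"
    then obtain e0 where e0: "e0 > 0" "\<And>d e. 0 < d \<Longrightarrow> d \<le> e \<Longrightarrow> e \<le> e0 \<Longrightarrow> dist (x_min d) (x_min e) < \<eta>"
      using cau by meson
    obtain N where N: "\<And>n. n \<ge> N \<Longrightarrow> inverse (real (Suc n)) \<le> e0"
      using inv0[OF e0(1)] by (auto simp: eventually_sequentially)
    have "dist (?u j) (?u k) < \<eta>" if "j \<ge> N" "k \<ge> N" for j k
      using e0(2)[of "inverse (real (Suc j))" "inverse (real (Suc k))"]
        e0(2)[of "inverse (real (Suc k))" "inverse (real (Suc j))"] N[OF that(1)] N[OF that(2)]
      by (metis dist_commute inverse_positive_iff_positive linear of_nat_0_less_iff zero_less_Suc)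
    then show "\<exists>N. \<forall>j\<ge>N. \<forall>k\<ge>N. dist (?u j) (?u k) < \<eta>" by blast
  qed
  then obtain z where z: "?u \<longlonglongrightarrow> z" using Cauchy_convergent convergent_def by blast
  \<comment> \<open>\<open>cau\<close> holds for all small parameters, so the limit of the sequence
    is the limit along the whole filter.\<close>
  have lim: "(x_min \<longlongrightarrow> z) (at_right 0)"
  proof (rule tendstoI)
    fix \<eta> :: real assume \<eta>: "\<eta> > 0"
    then obtain e0 where e0: "e0 > 0" "\<And>d e. 0 < d \<Longrightarrow> d \<le> e \<Longrightarrow> e \<le> e0 \<Longrightarrow> dist (x_min d) (x_min e) < \<eta>/2"
      using cau[of "\<eta>/2"] by auto
    have "dist (x_min e) z < \<eta>" if e: "0 < e" "e < e0" for e
    proof -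
      have "eventually (\<lambda>n. dist (?u n) z < \<eta>/2 \<and> inverse (real (Suc n)) \<le> e) sequentially"
        using tendstoD[OF z, of "\<eta>/2"] \<eta> inv0[OF e(1)] by (auto intro: eventually_conj)
      then obtain n where "dist (?u n) z < \<eta>/2" "inverse (real (Suc n)) \<le> e"
        using eventually_happens' sequentially_bot by blast
      moreover from this have "dist (?u n) (x_min e) < \<eta>/2"
        using e by (intro e0(2)) auto
      ultimately show ?thesis
        using dist_triangle[of "x_min e" z "?u n"] by (simp add: dist_commute)
    qed
    then show "eventually (\<lambda>e. dist (x_min e) z < \<eta>) (at_right 0)"
      using e0(1) by (auto simp: eventually_at_right_field)
  qed
  have "g z \<le> g z0"
  proof (rule LIMSEQ_le)
    have "isCont g z" using g_continuous[of UNIV] by (simp add: continuous_on_eq_continuous_at)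
    then show "(\<lambda>n. g (?u n)) \<longlonglongrightarrow> g z" using z by (rule isCont_tendsto_compose)
    show "(\<lambda>n. g z0 + inverse (real (Suc n)) / 2 * (norm z0)\<^sup>2) \<longlonglongrightarrow> g z0"
      by (rule tendsto_eq_intros LIMSEQ_inverse_real_of_nat refl | simp)+
    \<comment> \<open>Comparison with the fixed minimizer \<open>z0\<close>, whose penalty vanishes
      in the limit.\<close>
    have "g (?u n) \<le> g z0 + inverse (real (Suc n)) / 2 * (norm z0)\<^sup>2" for n
    proof -
      have "0 \<le> inverse (real (Suc n)) / 2 * (norm (?u n))\<^sup>2" by simp
      moreover have "tikhonov g (inverse (real (Suc n))) (?u n) \<le> tikhonov g (inverse (real (Suc n))) z0"
        by (rule x_min_le) simp
      ultimately show ?thesis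
        using tikhonov_def[of g "inverse (real (Suc n))" "?u n"] tikhonov_def[of g "inverse (real (Suc n))" z0]
        by linarith
    qed
    then show "\<exists>N. \<forall>n\<ge>N. g (?u n) \<le> g z0 + inverse (real (Suc n)) / 2 * (norm z0)\<^sup>2" by blast
  qed
  then have zmin: "z \<in> argmin_set g" using z0 by (auto simp: argmin_set_def intro: order_trans)
  have "norm z \<le> norm y" if "y \<in> argmin_set g" for y
    by (rule LIMSEQ_le_const2[OF tendsto_norm[OF z]]) (use norm_x_min_le[OF _ that] in auto)
  with zmin lim show ?thesis using that by blast
qed

lemma convex_argmin_midpoint:
  assumes "y \<in> argmin_set g" "z \<in> argmin_set g" shows "(1/2) *\<^sub>R (y + z) \<in> argmin_set g"
proof -
  have "g y = g z" using assms by (auto simp: argmin_set_def intro: order_antisym)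
  then have "g ((1/2) *\<^sub>R (y + z)) \<le> g z"
    using convex_onD[OF g_convex, of "1/2" y z] by (simp add: scaleR_add_right)
  then show ?thesis using assms by (auto simp: argmin_set_def intro: order_trans)
qed
 
text \<open>The limit found in \<open>x_min_tendsto\<close> has least norm. By the parallelogram law
  the midpoint of two distinct elements of least norm would be shorter, so the \<open>THE\<close> in
  \<open>min_norm_element\<close> denotes this limit.\<close>

lemma min_norm_element_properties:
  shows min_norm_element_argmin: "min_norm_element (argmin_set g) \<in> argmin_set g"
    and x_min_tendsto_min_norm: "(x_min \<longlongrightarrow> min_norm_element (argmin_set g)) (at_right 0)"
proof -
  obtain z where z: "z \<in> argmin_set g" "\<And>y. y \<in> argmin_set g \<Longrightarrow> norm z \<le> norm y"
    "(x_min \<longlongrightarrow> z) (at_right 0)"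
    using x_min_tendsto by blast
  have "w = z" if w: "w \<in> argmin_set g" "\<forall>y\<in>argmin_set g. norm w \<le> norm y" for w
  proof -
    have eq: "norm w = norm z" using w z by (simp add: order_antisym)
    have "norm z \<le> norm ((1/2) *\<^sub>R (w + z))" by (intro z convex_argmin_midpoint w)
    then have "(norm z)\<^sup>2 \<le> (norm ((1/2) *\<^sub>R (w + z)))\<^sup>2" by simp
    also have "\<dots> = ((norm w)\<^sup>2 + (norm z)\<^sup>2) / 2 - (norm (w - z))\<^sup>2 / 4"
      unfolding power2_norm_eq_inner
      by (simp add: inner_add_left inner_add_right inner_diff_left inner_diff_right inner_commute field_simps)
    finally show ?thesis using eq by simp
  qed
  then have "min_norm_element (argmin_set g) = z"
    unfolding min_norm_element_def using z(1,2) by (intro the_equality conjI ballI) blast+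
  then show "min_norm_element (argmin_set g) \<in> argmin_set g"
    "(x_min \<longlongrightarrow> min_norm_element (argmin_set g)) (at_right 0)" using z(1,3) by simp_all
qed

end

section \<open>Differential inequalities for Dini derivatives\<close>

text \<open>The upper right Dini derivative of \<open>f\<close> at \<open>s\<close> is at most
  \<open>l\<close>. Stated as a linear bound with arbitrary slack \<eta>, it needs neither quotients
  nor a limes superior in the extended reals.\<close>

definition dini_le :: "(real \<Rightarrow> real) \<Rightarrow> real \<Rightarrow> real \<Rightarrow> bool" where
  "dini_le f s l \<longleftrightarrow> (\<forall>\<eta>>0. \<forall>\<^sub>F t in at_right s. f t \<le> f s + (l + \<eta>) * (t - s))"

text \<open>The entry point for Dini bounds: a majorant that touches \<open>f\<close> at
  \<open>s\<close> has to be differentiable at this one point only.\<close>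

lemma dini_le_majorant:
  assumes U: "(U has_real_derivative l) (at_right s)" and s: "U s = f s"
    and le: "\<forall>\<^sub>F t in at_right s. f t \<le> U t"
  shows "dini_le f s l"
  unfolding dini_le_def
proof (intro allI impI)
  fix \<eta> :: real assume "\<eta> > 0"
  then have "\<forall>\<^sub>F t in at_right s. (U t - U s) / (t - s) < l + \<eta>"
    using U unfolding has_field_derivative_iff by (intro order_tendstoD(2)[of _ l]) auto
  with le eventually_at_right_less[of s]
  show "\<forall>\<^sub>F t in at_right s. f t \<le> f s + (l + \<eta>) * (t - s)"
  proof eventually_elim
    case (elim t)
    then have "U t - U s < (l + \<eta>) * (t - s)" by (simp add: pos_divide_less_eq)
    then show ?case using elim s by linarith
  qed
qed

lemma dini_le_mono: "dini_le f s l \<Longrightarrow> l \<le> m \<Longrightarrow> dini_le f s m"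
  unfolding dini_le_def
proof (intro allI impI)
  fix \<eta> :: real
  assume f: "\<forall>\<eta>>0. \<forall>\<^sub>F t in at_right s. f t \<le> f s + (l + \<eta>) * (t - s)" and "l \<le> m" "\<eta> > 0"
  then have "\<forall>\<^sub>F t in at_right s. f t \<le> f s + (l + \<eta>) * (t - s)" by blast
  with eventually_at_right_less[of s]
  show "\<forall>\<^sub>F t in at_right s. f t \<le> f s + (m + \<eta>) * (t - s)"
  proof eventually_elim
    case (elim t)
    have "(l + \<eta>) * (t - s) \<le> (m + \<eta>) * (t - s)"
      using elim \<open>l \<le> m\<close> by (intro mult_right_mono) auto
    then show ?case using elim by linarith
  qed
qed

lemma dini_le_add:
  assumes f: "dini_le f s l" and h: "(h has_real_derivative d) (at_right s)"
  shows "dini_le (\<lambda>t. f t + h t) s (l + d)"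
  unfolding dini_le_def
proof (intro allI impI)
  fix \<eta> :: real assume "\<eta> > 0"
  then have "\<forall>\<^sub>F t in at_right s. f t \<le> f s + (l + \<eta>/2) * (t - s)" "\<forall>\<^sub>F t in at_right s. h t \<le> h s + (d + \<eta>/2) * (t - s)"
    using f dini_le_majorant[OF h] unfolding dini_le_def by auto
  then show "\<forall>\<^sub>F t in at_right s. f t + h t \<le> f s + h s + (l + d + \<eta>) * (t - s)"
    by eventually_elim (simp add: field_simps)
qed

text \<open>The slope is controlled only where \<open>f\<close> is positive, as is typical of a
  barrier. At the last time \<open>s\<close> at which \<open>f\<close> is not above the rising line
  \<open>\<eta> * (1 + t - a)\<close>, it lies on the line and is positive; from there it cannot
  rise faster than the line, contradicting the choice of \<open>s\<close>.\<close>

lemma dini_barrier: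
  assumes ab: "a \<le> b" and cont: "continuous_on {a..b} f" and a: "f a \<le> 0"
    and dini: "\<And>s. a \<le> s \<Longrightarrow> s < b \<Longrightarrow> f s > 0 \<Longrightarrow> dini_le f s 0"
  shows "f b \<le> 0"
proof (rule ccontr)
  assume "\<not> f b \<le> 0"
  \<comment> \<open>The summand 1 keeps the line positive already at \<open>a\<close>; \<eta> is so
    small that \<open>f b\<close> lies above the line.\<close>
  define d where "d = 1 + b - a"
  define \<eta> where "\<eta> = f b / 2 / d"
  have "d > 0" using ab by (simp add: d_def)
  then have "\<eta> > 0" "\<eta> * d = f b / 2"
    using \<open>\<not> f b \<le> 0\<close> by (auto simp: \<eta>_def)
  then have \<eta>: "\<eta> > 0" "\<eta> * (1 + b - a) < f b" using \<open>\<not> f b \<le> 0\<close> by (auto simp: d_def)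
  define h where "h = (\<lambda>t. f t - \<eta> * (1 + t - a))"
  define S where "S = {t \<in> {a..b}. h t \<le> 0}"
  have hc: "continuous_on {a..b} h" unfolding h_def by (intro continuous_intros cont)
  have "closed S" unfolding S_def
    by (intro continuous_on_closed_Collect_le hc continuous_intros)
  moreover have "bounded S" unfolding S_def by (rule bounded_subset[of "{a..b}"]) auto
  ultimately have "compact S" by (simp add: compact_eq_bounded_closed)
  moreover have "a \<in> S" using ab a \<eta> by (auto simp: S_def h_def)
  ultimately obtain s where s: "s \<in> S" "\<And>t. t \<in> S \<Longrightarrow> t \<le> s"
    using compact_attains_sup by (metis empty_iff)
  have "s < b" using s \<eta> by (auto simp: S_def h_def less_le)
  have pos: "h t > 0" if "s < t" "t \<le> b" for t 
    using s(1) s(2)[of t] that by (cases "h t \<le> 0") (auto simp: S_def)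
  have sab: "a \<le> s" using s by (auto simp: S_def)
  have "h s \<ge> 0"
  proof (rule tendsto_lowerbound)
    have "continuous_on {s..b} h" using hc by (rule continuous_on_subset) (use sab in auto)
    then have "(h \<longlongrightarrow> h s) (at s within {s..b})" using \<open>s < b\<close> by (auto simp: continuous_on_def)
    then show "(h \<longlongrightarrow> h s) (at_right s)" using \<open>s < b\<close> by (simp add: at_within_Icc_at_right)
    show "\<forall>\<^sub>F t in at_right s. 0 \<le> h t"
      using eventually_at_right_less[of s] eventually_at_right_real[OF \<open>s < b\<close>]
      by eventually_elim (use pos in \<open>auto intro: less_imp_le\<close>)
  qed simp
  then have "f s \<ge> \<eta> * (1 + s - a)" by (simp add: h_def)
  moreover have "\<eta> * (1 + s - a) > 0" using \<eta> sab by simp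
  ultimately have "dini_le f s 0" using dini sab \<open>s < b\<close> by simp
  then have "\<forall>\<^sub>F t in at_right s. f t \<le> f s + \<eta> * (t - s)"
    using \<eta> unfolding dini_le_def by simp
  then have "\<forall>\<^sub>F t in at_right s. False"
    using eventually_at_right_less[of s] eventually_at_right_real[OF \<open>s < b\<close>]
  proof eventually_elim
    case (elim t)
    then have "h t > 0" using pos by auto
    moreover have "h s \<le> 0" using s by (simp add: S_def)
    moreover have "\<eta> * (t - s) = \<eta> * (1 + t - a) - \<eta> * (1 + s - a)" by (simp add: algebra_simps)
    ultimately show ?case using elim unfolding h_def by linarith
  qed
  then show False by simp
qed

text \<open>Subtracting a primitive of \<open>h\<close> reduces this to \<open>dini_barrier\<close>.
  It replaces the fundamental theorem of calculus for an \<open>E\<close> that need not be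
  differentiable.\<close>

lemma dini_le_integral_bound:
  assumes Tb: "T \<le> b" and E: "continuous_on {T..b} E" and h: "continuous_on {T..b} h"
    and dini: "\<And>s. T \<le> s \<Longrightarrow> s < b \<Longrightarrow> dini_le E s (h s)"
  shows "E b \<le> E T + integral {T..b} h"
proof -
  define f where "f = (\<lambda>t. E t + (- E T - integral {T..t} h))"
  have "f b \<le> 0"
  proof (rule dini_barrier[OF Tb])
    show "continuous_on {T..b} f" unfolding f_def
      by (intro continuous_intros E indefinite_integral_continuous_1 integrable_continuous_interval h)
    show "f T \<le> 0" by (simp add: f_def)
  next
    fix s assume s: "T \<le> s" "s < b"
    have "((\<lambda>t. integral {T..t} h) has_real_derivative h s) (at s within {T..b})"
      by (intro integral_has_real_derivative h) (use s in auto)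
    then have "((\<lambda>t. integral {T..t} h) has_real_derivative h s) (at s within {s..b})"
      by (rule DERIV_subset) (use s in auto)
    then have d: "((\<lambda>t. integral {T..t} h) has_real_derivative h s) (at_right s)"
      using s by (simp add: at_within_Icc_at_right)
    have "((\<lambda>t. - E T - integral {T..t} h) has_real_derivative - h s) (at_right s)"
      by (auto intro!: derivative_eq_intros d)
    from dini_le_add[OF dini[OF s] this] show "dini_le f s 0" by (simp add: f_def)
  qed
  then show ?thesis by (simp add: f_def)
qed

section \<open>Integrability on half-lines\<close>

lemma set_integrable_nonneg_continuous:
  fixes f :: "real \<Rightarrow> real"
  assumes cont: "continuous_on {T..} f" and nonneg: "\<And>t. t \<ge> T \<Longrightarrow> f t \<ge> 0"
    and bound: "\<And>b. b \<ge> T \<Longrightarrow> integral {T..b} f \<le> C"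
  shows "set_integrable lborel {T..} f"
proof -
  define F where "F = (\<lambda>k::nat. \<lambda>t. if t \<in> {T..T + real k} then f t else 0)"
  have int: "f integrable_on {T..T + real k}" for k
    by (intro integrable_continuous_interval continuous_on_subset[OF cont]) auto
  have sub: "{T..} \<inter> {T..T + real k} = {T..T + real k}" for k by auto
  have Fint: "F k integrable_on {T..}" for k
    unfolding F_def using int[of k] by (subst integrable_restrict_Int) (simp add: sub)
  have Feq: "integral {T..} (F k) = integral {T..T + real k} f" for k
    unfolding F_def by (subst integral_restrict_Int) (simp add: sub)
  have "f integrable_on {T..} \<and> (\<lambda>k. integral {T..} (F k)) \<longlonglongrightarrow> integral {T..} f"
  proof (rule monotone_convergence_increasing)
    show "F k integrable_on {T..}" for k by (rule Fint)
    show "F k t \<le> F (Suc k) t" if "t \<in> {T..}" for k t using that nonneg by (auto simp: F_def)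
    show "(\<lambda>k. F k t) \<longlonglongrightarrow> f t" if "t \<in> {T..}" for t
    proof (rule tendsto_eventually)
      obtain N :: nat where N: "t - T \<le> real N" using real_arch_simple by blast
      show "\<forall>\<^sub>F k in sequentially. F k t = f t"
        using eventually_ge_at_top[of N]
        by eventually_elim (use that N in \<open>auto simp: F_def\<close>)
    qed
    have "0 \<le> integral {T..T + real k} f" for k
      by (intro integral_nonneg int) (use nonneg in auto)
    then have "\<bar>integral {T..} (F k)\<bar> \<le> C" for k
      using bound[of "T + real k"] by (simp add: Feq)
    then show "bounded (range (\<lambda>k. integral {T..} (F k)))"
      by (auto simp: bounded_iff)
  qed
  then have "f absolutely_integrable_on {T..}"
    using nonneg by (subst absolutely_integrable_on_iff_nonneg) auto
  \<comment> \<open>Absolute integrability refers to the completed Lebesgue measure; Borel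
    measurability of the continuous integrand brings the result back to
    \<open>lborel\<close>.\<close>
  moreover have "(\<lambda>t. indicator {T..} t *\<^sub>R f t) \<in> borel_measurable borel"
    by (rule borel_measurable_continuous_on_indicator[OF _ cont]) simp
  ultimately show ?thesis
    unfolding set_integrable_def by (subst (asm) integrable_completion) auto
qed

text \<open>\<open>E\<close> cannot fall below 0, so the integral of \<open>Q\<close> over any
  \<open>{T..b}\<close> is at most \<open>E T\<close> plus the whole integral of
  \<open>R\<close>.\<close>

lemma set_integrable_dissipation:
  assumes E: "continuous_on {T..} E" "\<And>t. t \<ge> T \<Longrightarrow> E t \<ge> 0"
    and Q: "continuous_on {T..} Q" "\<And>t. t \<ge> T \<Longrightarrow> Q t \<ge> 0"
    and R: "continuous_on {T..} R" "\<And>t. t \<ge> T \<Longrightarrow> R t \<ge> 0" "set_integrable lborel {T..} R"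
    and dini: "\<And>s. T \<le> s \<Longrightarrow> dini_le E s (R s - Q s)"
  shows "set_integrable lborel {T..} Q"
proof (rule set_integrable_nonneg_continuous[OF Q])
  fix b assume b: "b \<ge> T"
  have c: "continuous_on {T..b} E" "continuous_on {T..b} Q" "continuous_on {T..b} R"
    by (auto intro: continuous_on_subset E Q R)
  have "E b \<le> E T + integral {T..b} (\<lambda>s. R s - Q s)"
    by (intro dini_le_integral_bound b c dini continuous_on_diff)
  also have "integral {T..b} (\<lambda>s. R s - Q s) = integral {T..b} R - integral {T..b} Q"
    by (intro integral_diff integrable_continuous_interval c)
  finally have "integral {T..b} Q \<le> E T + integral {T..b} R" using E(2)[OF b] by simp
  also have "integral {T..b} R \<le> integral {T..} R"
    by (intro integral_subset_le integrable_continuous_interval c set_borel_integral_eq_integral(1) R)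
      (use R(2) in auto)
  finally show "integral {T..b} Q \<le> E T + integral {T..} R" by simp
qed

text \<open>Estimates along the trajectory hold only from some \<open>T\<close> on; on the compact
  initial interval continuity is enough.\<close>

lemma set_integrable_continuous_bound:
  fixes f h :: "real \<Rightarrow> real"
  assumes T: "t0 \<le> T" and f: "continuous_on {t0..} f"
    and bound: "\<And>t. t \<ge> T \<Longrightarrow> \<bar>f t\<bar> \<le> h t" and h: "set_integrable lborel {T..} h"
  shows "set_integrable lborel {t0..} f"
proof -
  have "set_integrable lborel {t0..T} f"
    by (rule borel_integrable_atLeastAtMost') (auto intro: continuous_on_subset[OF f])
  moreover have "set_integrable lborel {T..} f"
    unfolding set_integrable_def
  proof (rule Bochner_Integration.integrable_bound[OF h[unfolded set_integrable_def]])
    show "(\<lambda>t. indicator {T..} t *\<^sub>R f t) \<in> borel_measurable lborel"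
      using borel_measurable_continuous_on_indicator[of "{T..}" f] continuous_on_subset[OF f] T by auto
    show "AE t in lborel. norm (indicator {T..} t *\<^sub>R f t) \<le> norm (indicator {T..} t *\<^sub>R h t)"
      by (rule AE_I2) (use bound in \<open>force simp: indicator_def\<close>)
  qed
  ultimately have "set_integrable lborel ({t0..T} \<union> {T..}) f" by (intro set_integrable_Un) auto
  moreover have "{t0..T} \<union> {T..} = {t0..}" using T by auto
  ultimately show ?thesis by simp
qed

lemma set_integrable_powr:
  fixes p T :: real
  assumes "p < -1" "0 < T" shows "set_integrable lborel {T..} (\<lambda>t. t powr p)"
proof -
  have "continuous_on {T..} (\<lambda>t. t powr p)" 
    by (intro continuous_on_powr continuous_on_id continuous_on_const) (use assms in auto)
  moreover have "integral {T..b} (\<lambda>t. t powr p) \<le> T powr (p + 1) / (- (p + 1))" if b: "b \<ge> T" for b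
  proof -
    have "((\<lambda>t. t powr p) has_integral (b powr (p + 1) / (p + 1) - T powr (p + 1) / (p + 1))) {T..b}"
    proof (rule fundamental_theorem_of_calculus[OF b])
      fix t assume "t \<in> {T..b}"
      then have "((\<lambda>t. t powr (p + 1) / (p + 1)) has_real_derivative t powr p) (at t within {T..b})"
        using assms by (auto intro!: derivative_eq_intros)
      then show "((\<lambda>t. t powr (p + 1) / (p + 1)) has_vector_derivative t powr p) (at t within {T..b})"
        by (simp add: has_real_derivative_iff_has_vector_derivative)
    qed
    moreover have "b powr (p + 1) / (p + 1) \<le> 0" using assms by (intro divide_nonneg_nonpos) auto
    moreover have "T powr (p + 1) / (- (p + 1)) = - (T powr (p + 1) / (p + 1))"
      by (rule minus_divide_right[symmetric])
    ultimately show ?thesis by (simp add: integral_unique)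
  qed
  ultimately show ?thesis by (intro set_integrable_nonneg_continuous[where C = "T powr (p + 1) / (- (p + 1))"]) auto
qed

section \<open>Dissipation of the energy\<close>

lemma young_inequality:
  fixes u w \<delta> :: real
  assumes "\<delta> > 0" shows "u * w \<le> \<delta> * u\<^sup>2 + w\<^sup>2 / (4 * \<delta>)"
proof -
  have "0 \<le> (2 * \<delta> * u - w)\<^sup>2 / (4 * \<delta>)" using assms by simp
  also have "\<dots> = \<delta> * u\<^sup>2 + w\<^sup>2 / (4 * \<delta>) - u * w"
    using assms by (simp add: power2_eq_square field_simps)
  finally show ?thesis by simp
qed

text \<open>The pure inequality behind the decay of the energy: \<open>e' = - \<epsilon>'\<close>, \<open>\<tau>\<close> is \<open>T / t\<close>, and the
  numbers \<open>vA\<close>, \<open>pv\<close>, \<open>pA\<close> stand for the inner products of \<open>v\<close>, \<open>A\<close> and \<open>p = x - x\<^sub>t\<close>.  The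
  fractions in the smallness assumptions only have to leave some room below \<open>5/8\<close> after
  \<open>(17/32) * (17/16)\<close>, where \<open>17/32\<close> is slightly more than the \<open>1/2\<close> of (C2).\<close>
lemma dissipation_inequality:
  fixes T \<tau> e e' b m \<alpha> \<beta> q \<kappa> D P V S X Y Z N vA pv pA :: real
  assumes pos: "T > 0" "\<tau> \<ge> 0" "e > 0" "e' \<ge> 0" "b > 0" "\<alpha> > 0" "\<kappa> \<ge> 0"
    and nonneg: "D \<ge> 0" "P \<ge> 0" "V \<ge> 0" "S \<ge> 0"
    and cs: "\<bar>vA\<bar> \<le> V * S" "\<bar>pv\<bar> \<le> P * V"
    and conv: "pA + b * vA + e * b\<^sup>2 * V\<^sup>2 \<ge> D + e / 2 * P\<^sup>2 + e / 2 * b\<^sup>2 * V\<^sup>2"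
    and Z: "Z\<^sup>2 \<le> X\<^sup>2"
    and N: "N \<le> \<alpha> / 4 * P + T * V"
    and m: "T\<^sup>2 * (m - 1) = - q * \<beta> * \<tau> - \<alpha> * b * T"
    and small1: "2 * q * \<tau> \<le> \<alpha> / 8" "0 \<le> q"
    and small2: "e * T * b \<le> 17/32 * \<alpha>" "m \<le> 17/16" "\<alpha> / 4 * e * b\<^sup>2 / 2 \<le> \<alpha> / 60" "q * \<tau> \<le> \<alpha> / 60"
    and small3: "q\<^sup>2 * \<beta>\<^sup>2 * \<tau>\<^sup>2 / (b * T ^ 3) + 4 * \<alpha>\<^sup>2 * (b / T) \<le> \<alpha> / 60"
    and small4: "16 * q\<^sup>2 * \<tau>\<^sup>2 \<le> T\<^sup>2 * e"
  shows "2 * q * \<tau> * T * D + T\<^sup>2 * (m * vA - b * S\<^sup>2 + e * b * m * V\<^sup>2 - e * b\<^sup>2 * vA - e' / 2 * (Y\<^sup>2 - Z\<^sup>2))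
      + (\<alpha> / 4 * (\<alpha> / 4 - \<alpha> + q * \<tau>) * pv - \<alpha> / 4 * T * pA + T * (\<alpha> / 4 - \<alpha> + q * \<tau>) * V\<^sup>2 - T\<^sup>2 * vA)
      + 3 * \<alpha>\<^sup>2 / 16 * pv + \<kappa> * (\<alpha> / 4 * N + 3 * \<alpha>\<^sup>2 / 16 * P)
    \<le> - (\<alpha> / 8 * T * D + \<alpha> / 16 * T * e * P\<^sup>2 + \<alpha> / 16 * T * V\<^sup>2 + b / 2 * T\<^sup>2 * S\<^sup>2)
      + (T\<^sup>2 * e' * X\<^sup>2 / 2 + \<alpha> ^ 3 / 2 * \<kappa>\<^sup>2 / (T * e) + \<alpha> / 2 * T * \<kappa>\<^sup>2)"
proof -
  \<comment> \<open>The coefficient of \<open>vA\<close> once \<open>conv'\<close> has contributed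
    \<open>\<alpha> / 4 * T * b\<close>. By hypothesis \<open>m\<close> the terms of order
    \<open>T\<^sup>2\<close> cancel; \<open>b * T\<close> times a bounded factor and a small term
    remain.\<close>
  define K where "K = - q * \<beta> * \<tau> - b * T * (3/4 * \<alpha> + e * T * b)"
  have K: "T\<^sup>2 * m - T\<^sup>2 * e * b\<^sup>2 - T\<^sup>2 + \<alpha> / 4 * T * b = K"
    using m unfolding K_def by (simp add: power2_eq_square algebra_simps)
  have conv': "- \<alpha> / 4 * T * pA \<le> \<alpha> / 4 * T * (b * vA + e * b\<^sup>2 / 2 * V\<^sup>2 - D - e / 2 * P\<^sup>2)"
  proof -
    have "- pA \<le> b * vA + e * b\<^sup>2 / 2 * V\<^sup>2 - D - e / 2 * P\<^sup>2" using conv by (simp add: field_simps)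
    then have "\<alpha> / 4 * T * (- pA) \<le> \<alpha> / 4 * T * (b * vA + e * b\<^sup>2 / 2 * V\<^sup>2 - D - e / 2 * P\<^sup>2)"
      using pos by (intro mult_left_mono) auto
    then show ?thesis by simp
  qed
  have tD: "2 * q * \<tau> * T * D \<le> \<alpha> / 8 * T * D"
    using small1 pos nonneg by (intro mult_right_mono) auto
  \<comment> \<open>Half of the dissipated \<open>b * T\<^sup>2 * S\<^sup>2\<close> is spent here;
    \<open>small3\<close> makes the complementary Young term a small multiple of
    \<open>T * V\<^sup>2\<close>.\<close>
  have KvA: "K * vA \<le> b / 2 * T\<^sup>2 * S\<^sup>2 + T * \<alpha> / 60 * V\<^sup>2"
  proof -
    have "K * vA \<le> \<bar>K\<bar> * (V * S)"
      using abs_ge_self[of "K * vA"] mult_left_mono[OF cs(1) abs_ge_zero[of K]] by (simp only: abs_mult)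
    also have "\<dots> = S * (\<bar>K\<bar> * V)" by simp
    also have "\<dots> \<le> (b / 2 * T\<^sup>2) * S\<^sup>2 + (\<bar>K\<bar> * V)\<^sup>2 / (4 * (b / 2 * T\<^sup>2))"
      using pos by (intro young_inequality) simp
    also have "(\<bar>K\<bar> * V)\<^sup>2 / (4 * (b / 2 * T\<^sup>2)) = K\<^sup>2 / (2 * b * T\<^sup>2) * V\<^sup>2"
      by (simp add: power_mult_distrib)
    also have "K\<^sup>2 / (2 * b * T\<^sup>2) * V\<^sup>2 \<le> (T * \<alpha> / 60) * V\<^sup>2"
    proof (intro mult_right_mono)
      have r: "0 \<le> 3/4 * \<alpha> + e * T * b" "3/4 * \<alpha> + e * T * b \<le> 2 * \<alpha>"
        using pos small2(1) by auto
      have "(u - w)\<^sup>2 \<le> 2 * u\<^sup>2 + 2 * w\<^sup>2" for u w :: real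
        using zero_le_power2[of "u + w"] by (simp add: power2_eq_square algebra_simps)
      from this[of "- q * \<beta> * \<tau>"] have "K\<^sup>2 \<le> 2 * (- q * \<beta> * \<tau>)\<^sup>2 + 2 * (b * T * (3/4 * \<alpha> + e * T * b))\<^sup>2"
        unfolding K_def .
      also have "\<dots> = 2 * (q\<^sup>2 * \<beta>\<^sup>2 * \<tau>\<^sup>2) + 2 * (b\<^sup>2 * T\<^sup>2 * (3/4 * \<alpha> + e * T * b)\<^sup>2)"
        by (simp add: power_mult_distrib)
      also have "\<dots> \<le> 2 * (q\<^sup>2 * \<beta>\<^sup>2 * \<tau>\<^sup>2) + 2 * (b\<^sup>2 * T\<^sup>2 * (2 * \<alpha>)\<^sup>2)"
        by (intro add_left_mono mult_left_mono power_mono r) auto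
      also have "\<dots> = 2 * b * T ^ 3 * (q\<^sup>2 * \<beta>\<^sup>2 * \<tau>\<^sup>2 / (b * T ^ 3) + 4 * \<alpha>\<^sup>2 * (b / T))"
        using pos by (simp add: field_simps power2_eq_square power3_eq_cube)
      also have "\<dots> \<le> 2 * b * T ^ 3 * (\<alpha> / 60)"
        using pos by (intro mult_left_mono small3) auto
      also have "\<dots> = T * \<alpha> / 60 * (2 * b * T\<^sup>2)" by (simp add: power2_eq_square power3_eq_cube)
      finally show "K\<^sup>2 / (2 * b * T\<^sup>2) \<le> T * \<alpha> / 60"
        using pos by (simp add: pos_divide_le_eq)
    qed simp
    finally show ?thesis by simp
  qed
  \<comment> \<open>In multiples of \<alpha> the budget is 289/512 + 3/60 + 1/8 < 3/4; one of the
    three sixtieths comes from \<open>KvA\<close>.\<close>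
  have VV: "(T\<^sup>2 * e * b * m + \<alpha> / 4 * T * e * b\<^sup>2 / 2 - T * (3/4 * \<alpha> - q * \<tau>) + T * \<alpha> / 60) * V\<^sup>2 \<le> - \<alpha> / 8 * T * V\<^sup>2"
  proof (rule mult_right_mono)
    have "e * T * b * m \<le> e * T * b * (17/16)" using pos small2 by (intro mult_left_mono) auto
    also have "\<dots> \<le> 289/512 * \<alpha>" using small2(1) by argo
    finally have "e * T * b * m + \<alpha> / 4 * e * b\<^sup>2 / 2 - (3/4 * \<alpha> - q * \<tau>) + \<alpha> / 60 \<le> - \<alpha> / 8"
      using small2 pos by argo
    then have "T * (e * T * b * m + \<alpha> / 4 * e * b\<^sup>2 / 2 - (3/4 * \<alpha> - q * \<tau>) + \<alpha> / 60) \<le> T * (- \<alpha> / 8)"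
      using pos by (intro mult_left_mono) auto
    then show "T\<^sup>2 * e * b * m + \<alpha> / 4 * T * e * b\<^sup>2 / 2 - T * (3/4 * \<alpha> - q * \<tau>) + T * \<alpha> / 60 \<le> - \<alpha> / 8 * T"
      by (simp add: algebra_simps power2_eq_square)
  qed simp
  \<comment> \<open>Of the inner product \<open>pv\<close> only this part survives, since
    \<open>\<alpha> / 4 * (\<alpha> / 4 - \<alpha>)\<close> is cancelled by
    \<open>3 * \<alpha>\<^sup>2 / 16\<close>.\<close>
  have y1: "\<alpha> / 4 * q * \<tau> * pv \<le> \<alpha> / 32 * T * V\<^sup>2 + \<alpha> / 32 * T * e * P\<^sup>2"
  proof -
    have "\<alpha> / 4 * q * \<tau> * pv \<le> \<alpha> / 4 * q * \<tau> * (P * V)"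
      using cs(2) pos small1 by (intro mult_left_mono) auto
    also have "\<dots> = V * (\<alpha> / 4 * q * \<tau> * P)" by simp
    also have "\<dots> \<le> (\<alpha> / 32 * T) * V\<^sup>2 + (\<alpha> / 4 * q * \<tau> * P)\<^sup>2 / (4 * (\<alpha> / 32 * T))"
      using pos by (intro young_inequality) simp
    also have "(\<alpha> / 4 * q * \<tau> * P)\<^sup>2 / (4 * (\<alpha> / 32 * T)) = \<alpha> / 32 * P\<^sup>2 / T * (16 * q\<^sup>2 * \<tau>\<^sup>2)"
      using pos by (simp add: field_simps power2_eq_square)
    also have "\<dots> \<le> \<alpha> / 32 * P\<^sup>2 / T * (T\<^sup>2 * e)"
      using pos by (intro mult_left_mono small4) auto
    also have "\<dots> = \<alpha> / 32 * T * e * P\<^sup>2" using pos by (simp add: field_simps power2_eq_square)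
    finally show ?thesis by simp
  qed
  \<comment> \<open>\<open>y1\<close> and \<open>y2\<close> each take \<alpha>/32 from the
    \<alpha>/8 available for \<open>T * e * P\<^sup>2\<close>, and \<open>y1\<close> and
    \<open>y3\<close> do the same for \<open>T * V\<^sup>2\<close>; this leaves the \<alpha>/16 of
    the conclusion.\<close>
  have y2: "P * (\<kappa> * \<alpha>\<^sup>2 / 4) \<le> \<alpha> / 32 * T * e * P\<^sup>2 + \<alpha> ^ 3 / 2 * \<kappa>\<^sup>2 / (T * e)"
  proof -
    have "P * (\<kappa> * \<alpha>\<^sup>2 / 4) \<le> (\<alpha> / 32 * T * e) * P\<^sup>2 + (\<kappa> * \<alpha>\<^sup>2 / 4)\<^sup>2 / (4 * (\<alpha> / 32 * T * e))"
      using pos by (intro young_inequality) simp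
    also have "(\<kappa> * \<alpha>\<^sup>2 / 4)\<^sup>2 / (4 * (\<alpha> / 32 * T * e)) = \<alpha> ^ 3 / 2 * \<kappa>\<^sup>2 / (T * e)"
      using pos by (simp add: field_simps power2_eq_square power3_eq_cube)
    finally show ?thesis .
  qed
  have y3: "V * (\<kappa> * \<alpha> * T / 4) \<le> \<alpha> / 32 * T * V\<^sup>2 + \<alpha> / 2 * T * \<kappa>\<^sup>2"
  proof -
    have "V * (\<kappa> * \<alpha> * T / 4) \<le> (\<alpha> / 32 * T) * V\<^sup>2 + (\<kappa> * \<alpha> * T / 4)\<^sup>2 / (4 * (\<alpha> / 32 * T))"
      using pos by (intro young_inequality) simp
    also have "(\<kappa> * \<alpha> * T / 4)\<^sup>2 / (4 * (\<alpha> / 32 * T)) = \<alpha> / 2 * T * \<kappa>\<^sup>2"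
      using pos by (simp add: field_simps power2_eq_square)
    finally show ?thesis .
  qed
  have kN: "\<kappa> * (\<alpha> / 4 * N + 3 * \<alpha>\<^sup>2 / 16 * P) \<le> P * (\<kappa> * \<alpha>\<^sup>2 / 4) + V * (\<kappa> * \<alpha> * T / 4)"
  proof -
    have "\<alpha> / 4 * N \<le> \<alpha> / 4 * (\<alpha> / 4 * P + T * V)" using N pos by (intro mult_left_mono) auto
    then have "\<kappa> * (\<alpha> / 4 * N + 3 * \<alpha>\<^sup>2 / 16 * P) \<le> \<kappa> * (\<alpha> / 4 * (\<alpha> / 4 * P + T * V) + 3 * \<alpha>\<^sup>2 / 16 * P)"
      using pos by (intro mult_left_mono) auto
    also have "\<dots> = P * (\<kappa> * \<alpha>\<^sup>2 / 4) + V * (\<kappa> * \<alpha> * T / 4)" by (simp add: field_simps power2_eq_square)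
    finally show ?thesis .
  qed
  have eX: "T\<^sup>2 * (- e' / 2 * (Y\<^sup>2 - Z\<^sup>2)) \<le> T\<^sup>2 * e' * X\<^sup>2 / 2"
  proof -
    have "- (Y\<^sup>2 - Z\<^sup>2) \<le> X\<^sup>2" using Z zero_le_power2[of Y] by linarith
    then have "T\<^sup>2 * (e' / 2) * (- (Y\<^sup>2 - Z\<^sup>2)) \<le> T\<^sup>2 * (e' / 2) * X\<^sup>2" using pos by (intro mult_left_mono) auto
    then show ?thesis by (simp add: algebra_simps)
  qed
  have "2 * q * \<tau> * T * D + T\<^sup>2 * (m * vA - b * S\<^sup>2 + e * b * m * V\<^sup>2 - e * b\<^sup>2 * vA - e' / 2 * (Y\<^sup>2 - Z\<^sup>2))
      + (\<alpha> / 4 * (\<alpha> / 4 - \<alpha> + q * \<tau>) * pv - \<alpha> / 4 * T * pA + T * (\<alpha> / 4 - \<alpha> + q * \<tau>) * V\<^sup>2 - T\<^sup>2 * vA)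
      + 3 * \<alpha>\<^sup>2 / 16 * pv
    = 2 * q * \<tau> * T * D + (T\<^sup>2 * m - T\<^sup>2 * e * b\<^sup>2 - T\<^sup>2) * vA - b * T\<^sup>2 * S\<^sup>2
      + (T\<^sup>2 * e * b * m - T * (3/4 * \<alpha> - q * \<tau>)) * V\<^sup>2 + T\<^sup>2 * (- e' / 2 * (Y\<^sup>2 - Z\<^sup>2))
      + \<alpha> / 4 * q * \<tau> * pv + (- \<alpha> / 4 * T * pA)"
    by (simp add: field_simps power2_eq_square)
  also have "\<dots> \<le> \<alpha> / 8 * T * D + (T\<^sup>2 * m - T\<^sup>2 * e * b\<^sup>2 - T\<^sup>2) * vA - b * T\<^sup>2 * S\<^sup>2
      + (T\<^sup>2 * e * b * m - T * (3/4 * \<alpha> - q * \<tau>)) * V\<^sup>2 + T\<^sup>2 * e' * X\<^sup>2 / 2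
      + (\<alpha> / 32 * T * V\<^sup>2 + \<alpha> / 32 * T * e * P\<^sup>2)
      + \<alpha> / 4 * T * (b * vA + e * b\<^sup>2 / 2 * V\<^sup>2 - D - e / 2 * P\<^sup>2)"
    using tD conv' y1 eX by linarith
  also have "\<dots> = - \<alpha> / 8 * T * D + K * vA - b * T\<^sup>2 * S\<^sup>2
      + (T\<^sup>2 * e * b * m + \<alpha> / 4 * T * e * b\<^sup>2 / 2 - T * (3/4 * \<alpha> - q * \<tau>)) * V\<^sup>2 + T\<^sup>2 * e' * X\<^sup>2 / 2
      + (\<alpha> / 32 * T * V\<^sup>2 + \<alpha> / 32 * T * e * P\<^sup>2) - \<alpha> / 8 * T * e * P\<^sup>2"
    unfolding K[symmetric] by (simp add: field_simps)
  also have "\<dots> \<le> - \<alpha> / 8 * T * D - b / 2 * T\<^sup>2 * S\<^sup>2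
      + (T\<^sup>2 * e * b * m + \<alpha> / 4 * T * e * b\<^sup>2 / 2 - T * (3/4 * \<alpha> - q * \<tau>) + T * \<alpha> / 60) * V\<^sup>2
      + T\<^sup>2 * e' * X\<^sup>2 / 2
      + (\<alpha> / 32 * T * V\<^sup>2 + \<alpha> / 32 * T * e * P\<^sup>2) - \<alpha> / 8 * T * e * P\<^sup>2"
    using KvA distrib_right[of "T\<^sup>2 * e * b * m + \<alpha> / 4 * T * e * b\<^sup>2 / 2 - T * (3/4 * \<alpha> - q * \<tau>)" "T * \<alpha> / 60" "V\<^sup>2"]
    by linarith
  also have "\<dots> \<le> - \<alpha> / 8 * T * D - b / 2 * T\<^sup>2 * S\<^sup>2 - \<alpha> / 8 * T * V\<^sup>2
      + T\<^sup>2 * e' * X\<^sup>2 / 2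
      + (\<alpha> / 32 * T * V\<^sup>2 + \<alpha> / 32 * T * e * P\<^sup>2) - \<alpha> / 8 * T * e * P\<^sup>2"
    using VV by linarith
  finally show ?thesis using kN y2 y3 by linarith
qed

section \<open>The trajectory, its energy and their derivatives\<close>

locale tikhonov_dynamics = convex_gradient g G
  for g :: "'a::{real_inner, complete_space} \<Rightarrow> real" and G +
  fixes \<epsilon> \<epsilon>' :: "real \<Rightarrow> real" and t0 \<alpha> \<beta> \<gamma> q r :: real and x v a :: "real \<Rightarrow> 'a"
  assumes grad_lipschitz: "\<And>S. bounded S \<Longrightarrow> \<exists>L. L-lipschitz_on S G"
    and t0_pos: "t0 > 0" and alpha_pos: "\<alpha> > 0" and q_pos: "0 < q" and q_less_1: "q < 1"
    and gamma_beta: "\<gamma> > 0 \<or> (\<gamma> = 0 \<and> \<beta> > 0)"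
    and eps_nonneg: "\<And>t. t \<ge> t0 \<Longrightarrow> \<epsilon> t \<ge> 0"
    and eps_noninc: "\<And>s t. t0 \<le> s \<Longrightarrow> s \<le> t \<Longrightarrow> \<epsilon> t \<le> \<epsilon> s"
    and eps_deriv: "\<And>t. t \<ge> t0 \<Longrightarrow> (\<epsilon> has_real_derivative \<epsilon>' t) (at t within {t0..})"
    and eps_lim: "(\<epsilon> \<longlongrightarrow> 0) at_top"
    and r_bounds: "q < r" "r < 1"
    and C1: "\<exists>K1>0. \<forall>\<^sub>F t in at_top. \<epsilon> t \<ge> K1 / t powr (r + q)"
    and C2: "\<gamma> \<noteq> 0 \<Longrightarrow> \<forall>\<^sub>F t in at_top. \<epsilon> t \<le> \<alpha> / (2 * \<gamma> * t powr q)"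
    and C3: "\<exists>K3>0. \<forall>\<^sub>F t in at_top. (\<epsilon>' t / \<epsilon> t)\<^sup>2 \<le> K3 / t\<^sup>2"
    and x_deriv: "\<And>t. t \<ge> t0 \<Longrightarrow> (x has_vector_derivative v t) (at t within {t0..})"
    and v_deriv: "\<And>t. t \<ge> t0 \<Longrightarrow> (v has_vector_derivative a t) (at t within {t0..})"
    and ode: "\<And>t. t \<ge> t0 \<Longrightarrow>
      a t + (\<alpha> / t powr q) *\<^sub>R v t + G (x t + beta_coeff \<gamma> \<beta> q t *\<^sub>R v t) + \<epsilon> t *\<^sub>R x t = 0"
begin

abbreviation b :: "real \<Rightarrow> real" where "b \<equiv> beta_coeff \<gamma> \<beta> q"
definition y :: "real \<Rightarrow> 'a" where "y t = x t + b t *\<^sub>R v t"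
definition xt :: "real \<Rightarrow> 'a" where "xt t = x_min (\<epsilon> t)"
definition A :: "real \<Rightarrow> 'a" where "A t = G (y t) + \<epsilon> t *\<^sub>R x t"
definition gap :: "real \<Rightarrow> real" where
  "gap t = tikhonov g (\<epsilon> t) (y t) - tikhonov g (\<epsilon> t) (xt t)"
text \<open>The coefficient of the velocity in the derivative of \<open>y\<close> after the equation
  has eliminated the acceleration; it tends to 1.\<close>

definition m :: "real \<Rightarrow> real" where
  "m t = 1 - q * \<beta> * t powr (- q - 1) - \<alpha> * b t / t powr q"
definition X :: real where "X = norm (min_norm_element (argmin_set g))"

text \<open>The comparison point \<open>z\<close> is an argument of its own: for fixed
  \<open>z\<close> this is differentiable in time, and the Dini derivative of \<open>energy\<close>
  is obtained by freezing \<open>z\<close> at the current minimizer.\<close>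

definition energy_at :: "'a \<Rightarrow> real \<Rightarrow> real" where
  "energy_at z t = (t powr q)\<^sup>2 * (tikhonov g (\<epsilon> t) (y t) - tikhonov g (\<epsilon> t) z)
     + (norm ((\<alpha> / 4) *\<^sub>R (x t - z) + (t powr q) *\<^sub>R v t))\<^sup>2 / 2
     + 3 * \<alpha>\<^sup>2 / 32 * (norm (x t - z))\<^sup>2"
definition energy :: "real \<Rightarrow> real" where "energy t = energy_at (xt t) t"

definition dissipation :: "real \<Rightarrow> real" where
  "dissipation t = \<alpha> / 8 * t powr q * gap t + \<alpha> / 16 * t powr q * \<epsilon> t * (norm (x t - xt t))\<^sup>2
     + \<alpha> / 16 * t powr q * (norm (v t))\<^sup>2 + b t / 2 * (t powr q)\<^sup>2 * (norm (A t))\<^sup>2"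

text \<open>(C1) gives positivity at late times only; monotonicity carries it back to all of
  \<open>{t0..}\<close>, where strong convexity and division by \<epsilon> need it.\<close>

lemma eps_pos: assumes "t \<ge> t0" shows "\<epsilon> t > 0"
proof -
  obtain K1 where K1: "K1 > 0" "\<forall>\<^sub>F s in at_top. \<epsilon> s \<ge> K1 / s powr (r + q)" using C1 by blast
  have "\<forall>\<^sub>F s in at_top. K1 / s powr (r + q) \<le> \<epsilon> s \<and> t \<le> s"
    using K1(2) eventually_ge_at_top[of t] by (rule eventually_conj)
  then obtain s where s: "K1 / s powr (r + q) \<le> \<epsilon> s" "t \<le> s"
    using eventually_happens' trivial_limit_at_top_linorder by blast
  then have "0 < K1 / s powr (r + q)" using K1 assms t0_pos by simp
  also have "\<dots> \<le> \<epsilon> s" by fact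
  also have "\<dots> \<le> \<epsilon> t" using eps_noninc assms s by simp
  finally show ?thesis .
qed

lemma eps'_nonpos: assumes "t \<ge> t0" shows "\<epsilon>' t \<le> 0"
proof (rule tendsto_upperbound)
  have "(\<epsilon> has_real_derivative \<epsilon>' t) (at_right t)"
    using eps_deriv[OF assms] by (rule DERIV_subset) (use assms in auto)
  then show "((\<lambda>s. (\<epsilon> s - \<epsilon> t) / (s - t)) \<longlongrightarrow> \<epsilon>' t) (at_right t)"
    by (simp add: has_field_derivative_iff)
  show "\<forall>\<^sub>F s in at_right t. (\<epsilon> s - \<epsilon> t) / (s - t) \<le> 0"
    using eventually_at_right_less[of t]
    by eventually_elim (use eps_noninc assms in \<open>auto intro!: divide_nonpos_pos\<close>)
qed simp

lemma norm_xt_le: "t \<ge> t0 \<Longrightarrow> norm (xt t) \<le> X"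
  unfolding xt_def X_def by (intro norm_x_min_le eps_pos min_norm_element_argmin)

lemma gap_growth: "t \<ge> t0 \<Longrightarrow> \<epsilon> t / 2 * (norm (y t - xt t))\<^sup>2 \<le> gap t"
  unfolding gap_def xt_def by (intro x_min_growth eps_pos)

lemma gap_nonneg: "t \<ge> t0 \<Longrightarrow> 0 \<le> gap t"
  unfolding gap_def xt_def using x_min_le[OF eps_pos] by simp

lemma xt_dist:
  assumes "t0 \<le> s" "s \<le> t" shows "norm (xt s - xt t) \<le> 2 * X * (\<epsilon> s - \<epsilon> t) / (\<epsilon> s + \<epsilon> t)"
  using x_min_lipschitz[of "\<epsilon> s" "\<epsilon> t" "min_norm_element (argmin_set g)"]
    eps_pos[of s] eps_pos[of t] eps_noninc[OF assms] assms min_norm_element_argmin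
  by (simp add: xt_def X_def)

lemma b_deriv:
  "t \<ge> t0 \<Longrightarrow> (b has_real_derivative (- q * \<beta> * t powr (- q - 1))) (at t within {t0..})"
  unfolding beta_coeff_def using t0_pos
  by (auto intro!: derivative_eq_intros simp: powr_diff powr_minus field_simps power2_eq_square)

lemma a_eq: "t \<ge> t0 \<Longrightarrow> a t = - (\<alpha> / t powr q) *\<^sub>R v t - A t"
  using ode[of t] by (simp add: A_def y_def algebra_simps eq_neg_iff_add_eq_0)

lemma y_deriv:
  assumes "t \<ge> t0" shows "(y has_vector_derivative m t *\<^sub>R v t - b t *\<^sub>R A t) (at t within {t0..})"
proof -
  have "((\<lambda>t. x t + b t *\<^sub>R v t) has_vector_derivative
      v t + (b t *\<^sub>R a t + (- q * \<beta> * t powr (- q - 1)) *\<^sub>R v t)) (at t within {t0..})"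
    by (intro has_vector_derivative_add has_vector_derivative_scaleR x_deriv v_deriv b_deriv assms)
  also have "(\<lambda>t. x t + b t *\<^sub>R v t) = y" by (simp add: y_def fun_eq_iff)
  also have "v t + (b t *\<^sub>R a t + (- q * \<beta> * t powr (- q - 1)) *\<^sub>R v t) = m t *\<^sub>R v t - b t *\<^sub>R A t"
    unfolding a_eq[OF assms] m_def by (simp add: algebra_simps)
  finally show ?thesis .
qed


lemma inner_self_deriv:
  assumes "(f has_vector_derivative f') (at t within S)"
  shows "((\<lambda>t. (norm (f t :: 'a))\<^sup>2) has_real_derivative 2 * (f t \<bullet> f')) (at t within S)"
  using has_derivative_inner[OF assms[unfolded has_vector_derivative_def] assms[unfolded has_vector_derivative_def]]
  unfolding power2_norm_eq_inner has_field_derivative_def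
  by (rule has_derivative_eq_rhs) (auto simp: fun_eq_iff inner_commute)

lemma g_y_deriv:
  assumes "t \<ge> t0"
  shows "((\<lambda>t. g (y t)) has_real_derivative (m t *\<^sub>R v t - b t *\<^sub>R A t) \<bullet> G (y t)) (at t within {t0..})"
  using has_derivative_compose[OF y_deriv[OF assms, unfolded has_vector_derivative_def]
      g_gradient[of "y t", unfolded gderiv_def]]
  unfolding has_field_derivative_def
  by (rule has_derivative_eq_rhs) (auto simp: fun_eq_iff)

lemma powr_power2_deriv:
  "t \<ge> t0 \<Longrightarrow> ((\<lambda>t. (t powr q)\<^sup>2) has_real_derivative 2 * q * t powr (q - 1) * t powr q) (at t within {t0..})"
  using t0_pos by (auto intro!: derivative_eq_intros)

text \<open>The product rule with the equation inserted. The gradient of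
  \<open>tikhonov g (\<epsilon> t)\<close> at \<open>y t\<close> appears as
  \<open>A t + (\<epsilon> t * b t) *\<^sub>R v t\<close>, since \<open>A\<close> carries the
  penalty at \<open>x t\<close> instead of \<open>y t\<close>.\<close>

definition energy_at_deriv :: "'a \<Rightarrow> real \<Rightarrow> real" where
  "energy_at_deriv z t = 2 * q * t powr (q - 1) * t powr q * (tikhonov g (\<epsilon> t) (y t) - tikhonov g (\<epsilon> t) z)
    + (t powr q)\<^sup>2 * ((m t *\<^sub>R v t - b t *\<^sub>R A t) \<bullet> (A t + (\<epsilon> t * b t) *\<^sub>R v t)
        + \<epsilon>' t / 2 * ((norm (y t))\<^sup>2 - (norm z)\<^sup>2))
    + ((\<alpha> / 4) *\<^sub>R (x t - z) + (t powr q) *\<^sub>R v t)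
        \<bullet> ((\<alpha> / 4 - \<alpha> + q * t powr (q - 1)) *\<^sub>R v t - (t powr q) *\<^sub>R A t)
    + 3 * \<alpha>\<^sup>2 / 16 * ((x t - z) \<bullet> v t)"

lemma energy_at_has_deriv:
  assumes t: "t \<ge> t0"
  shows "(energy_at z has_real_derivative energy_at_deriv z t) (at t within {t0..})"
proof -
  have tp: "t > 0" using t t0_pos by simp
  have W: "((\<lambda>t. (\<alpha> / 4) *\<^sub>R (x t - z) + (t powr q) *\<^sub>R v t) has_vector_derivative
      (\<alpha> / 4 - \<alpha> + q * t powr (q - 1)) *\<^sub>R v t - (t powr q) *\<^sub>R A t) (at t within {t0..})"
  proof -
    have d: "((\<lambda>t. (\<alpha> / 4) *\<^sub>R (x t - z) + (t powr q) *\<^sub>R v t) has_vector_derivative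
      ((\<alpha> / 4) *\<^sub>R (v t - 0) + ((t powr q) *\<^sub>R a t + (q * t powr (q - 1)) *\<^sub>R v t))) (at t within {t0..})"
      by (intro has_vector_derivative_add has_vector_derivative_scaleR has_vector_derivative_diff
          has_vector_derivative_const bounded_linear.has_vector_derivative[OF bounded_linear_scaleR_right] x_deriv v_deriv t)
        (use tp in \<open>auto intro!: derivative_eq_intros\<close>)
    have ta: "(t powr q) *\<^sub>R a t = - \<alpha> *\<^sub>R v t - (t powr q) *\<^sub>R A t"
      using tp by (simp add: a_eq[OF t] scaleR_diff_right)
    show ?thesis
      by (rule has_vector_derivative_eq_rhs[OF d], unfold ta,
          simp only: diff_zero scaleR_left_diff_distrib scaleR_add_left scaleR_minus_left, simp)
  qed
  have p: "((\<lambda>t. x t - z) has_vector_derivative v t) (at t within {t0..})"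
    using has_vector_derivative_diff[OF x_deriv[OF t] has_vector_derivative_const[of z]] by simp
  have tik: "((\<lambda>t. tikhonov g (\<epsilon> t) (y t) - tikhonov g (\<epsilon> t) z) has_real_derivative
      ((m t *\<^sub>R v t - b t *\<^sub>R A t) \<bullet> (A t + (\<epsilon> t * b t) *\<^sub>R v t)
        + \<epsilon>' t / 2 * ((norm (y t))\<^sup>2 - (norm z)\<^sup>2))) (at t within {t0..})"
  proof -
    have yA: "A t + (\<epsilon> t * b t) *\<^sub>R v t = G (y t) + \<epsilon> t *\<^sub>R y t"
      by (simp add: A_def y_def scaleR_add_right)
    have ed: "((\<lambda>t. \<epsilon> t / 2) has_real_derivative \<epsilon>' t / 2) (at t within {t0..})"
      by (rule DERIV_cdivide) (rule eps_deriv[OF t])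
    show ?thesis unfolding tikhonov_def yA
      by (rule DERIV_cong[OF DERIV_diff[OF DERIV_add[OF g_y_deriv[OF t]
              DERIV_mult[OF ed inner_self_deriv[OF y_deriv[OF t]]]]
            DERIV_add[OF DERIV_const DERIV_mult[OF ed DERIV_const]]]])
        (simp add: inner_add_right inner_commute[of "y t"] right_diff_distrib)
  qed
  show ?thesis
    unfolding energy_at_def energy_at_deriv_def
    by (rule DERIV_cong[OF DERIV_add[OF DERIV_add[OF DERIV_mult[OF powr_power2_deriv[OF t] tik]
              DERIV_cdivide[OF inner_self_deriv[OF W]]] DERIV_cmult[OF inner_self_deriv[OF p]]]])
      simp
qed

text \<open>The last summand is the price for moving \<open>xt\<close>: its speed is at most
  \<open>X * (- \<epsilon>') / \<epsilon>\<close>, while \<open>energy_at_deriv (xt s) s\<close> keeps it frozen at \<open>xt s\<close>.\<close>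
lemma energy_dini:
  assumes s: "s \<ge> t0"
  shows "dini_le energy s (energy_at_deriv (xt s) s
    + X * (- \<epsilon>' s) / \<epsilon> s * (\<alpha> / 4 * norm ((\<alpha> / 4) *\<^sub>R (x s - xt s) + (s powr q) *\<^sub>R v s)
        + 3 * \<alpha>\<^sup>2 / 16 * norm (x s - xt s)))"
proof -
  define W where "W = (\<lambda>t. (\<alpha> / 4) *\<^sub>R (x t - xt s) + (t powr q) *\<^sub>R v t)"
  \<comment> \<open>By \<open>xt_dist\<close> this bounds the displacement of \<open>xt\<close>
    between \<open>s\<close> and \<open>t\<close>. It vanishes at \<open>s\<close> and is
    differentiable there, which is not known of the displacement.\<close>
  define \<kappa> where "\<kappa> = (\<lambda>t. 2 * X * (\<epsilon> s - \<epsilon> t) / (\<epsilon> s + \<epsilon> t))"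
  \<comment> \<open>\<open>\<kappa> t * N t\<close> will dominate the cost of replacing
    \<open>xt s\<close> by \<open>xt t\<close> in the energy at time \<open>t\<close>.\<close>
  define N where "N = (\<lambda>t. (t powr q)\<^sup>2 * (\<epsilon> s - \<epsilon> t) * X + \<alpha> / 4 * norm (W t)
     + 3 * \<alpha>\<^sup>2 / 16 * norm (x t - xt s) + \<alpha>\<^sup>2 / 8 * \<kappa> t)"
  have es: "\<epsilon> s > 0" using eps_pos s by simp
  have \<kappa>d: "(\<kappa> has_real_derivative X * (- \<epsilon>' s) / \<epsilon> s) (at s within {t0..})"
    unfolding \<kappa>_def using es
    by (auto intro!: derivative_eq_intros eps_deriv[OF s] simp: field_simps power2_eq_square)
  have xc: "(x \<longlongrightarrow> x s) (at s within {t0..})" "(v \<longlongrightarrow> v s) (at s within {t0..})" "(\<epsilon> \<longlongrightarrow> \<epsilon> s) (at s within {t0..})"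
    using has_vector_derivative_continuous[OF x_deriv[OF s]] has_vector_derivative_continuous[OF v_deriv[OF s]]
      DERIV_continuous[OF eps_deriv[OF s]] by (auto simp: continuous_within)
  have \<kappa>c: "(\<kappa> \<longlongrightarrow> \<kappa> s) (at s within {t0..})"
    using DERIV_continuous[OF \<kappa>d] by (simp add: continuous_within)
  have Nc: "(N \<longlongrightarrow> N s) (at s within {t0..})"
    unfolding N_def W_def using s t0_pos by (intro tendsto_intros xc \<kappa>c) auto
  have \<kappa>s: "\<kappa> s = 0" by (simp add: \<kappa>_def)
  \<comment> \<open>\<open>N\<close> contains norms and may fail to be differentiable; its
    continuity at \<open>s\<close> suffices because the factor \<open>\<kappa>\<close> vanishes
    there.\<close>
  have "((\<lambda>t. \<kappa> t * N t) has_real_derivative X * (- \<epsilon>' s) / \<epsilon> s * N s) (at s within {t0..})"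
  proof -
    have "((\<lambda>t. (\<kappa> t - \<kappa> s) / (t - s) * N t) \<longlongrightarrow> X * (- \<epsilon>' s) / \<epsilon> s * N s) (at s within {t0..})"
      using \<kappa>d unfolding has_field_derivative_iff by (rule tendsto_mult) (rule Nc)
    then show ?thesis by (simp add: has_field_derivative_iff \<kappa>s)
  qed
  from DERIV_add[OF energy_at_has_deriv[OF s, of "xt s"] this]
  have "((\<lambda>t. energy_at (xt s) t + \<kappa> t * N t) has_real_derivative
      energy_at_deriv (xt s) s + X * (- \<epsilon>' s) / \<epsilon> s * N s) (at s within {t0..})" .
  then have "((\<lambda>t. energy_at (xt s) t + \<kappa> t * N t) has_real_derivative
      energy_at_deriv (xt s) s + X * (- \<epsilon>' s) / \<epsilon> s * N s) (at_right s)"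
    by (rule DERIV_subset) (use s in auto)
  then have "dini_le energy s (energy_at_deriv (xt s) s + X * (- \<epsilon>' s) / \<epsilon> s * N s)"
  proof (rule dini_le_majorant)
    show "energy_at (xt s) s + \<kappa> s * N s = energy s" by (simp add: energy_def \<kappa>s)
    show "\<forall>\<^sub>F t in at_right s. energy t \<le> energy_at (xt s) t + \<kappa> t * N t"
      using eventually_at_right_less[of s]
    proof eventually_elim
      case (elim t)
      define d where "d = xt s - xt t"
      have t: "t \<ge> t0" using elim s by simp
      have d: "norm d \<le> \<kappa> t" unfolding d_def \<kappa>_def using elim s by (intro xt_dist) auto
      have de: "\<epsilon> s - \<epsilon> t \<ge> 0" using eps_noninc[of s t] elim s by simp
      have sq: "(norm (u + c *\<^sub>R d))\<^sup>2 \<le> (norm u)\<^sup>2 + 2 * c * \<kappa> t * norm u + c\<^sup>2 * (\<kappa> t)\<^sup>2" if "c \<ge> 0" for u :: 'a and c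
      proof -
        have "norm (u + c *\<^sub>R d) \<le> norm u + c * \<kappa> t"
          using norm_triangle_ineq[of u "c *\<^sub>R d"] mult_left_mono[OF d that] that by simp
        then have "(norm (u + c *\<^sub>R d))\<^sup>2 \<le> (norm u + c * \<kappa> t)\<^sup>2" by (intro power_mono) auto
        then show ?thesis by (simp add: power2_eq_square algebra_simps)
      qed
      \<comment> \<open>Minimality of \<open>xt s\<close> for the parameter
        \<open>\<epsilon> s\<close> leaves only the change of the penalty. Both varying factors of
        the bound vanish at \<open>t = s\<close>, so this replacement contributes nothing to the
        derivative.\<close>
      have 1: "tikhonov g (\<epsilon> t) (xt s) - tikhonov g (\<epsilon> t) (xt t) \<le> (\<epsilon> s - \<epsilon> t) * X * \<kappa> t"
      proof -
        have "tikhonov g (\<epsilon> s) (xt s) \<le> tikhonov g (\<epsilon> s) (xt t)"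
          unfolding xt_def by (intro x_min_le es)
        then have "tikhonov g (\<epsilon> t) (xt s) - tikhonov g (\<epsilon> t) (xt t)
            \<le> (\<epsilon> s - \<epsilon> t) / 2 * ((norm (xt t))\<^sup>2 - (norm (xt s))\<^sup>2)"
          unfolding tikhonov_def by (simp add: field_simps)
        also have "(norm (xt t))\<^sup>2 - (norm (xt s))\<^sup>2 = (- d) \<bullet> (xt t + xt s)"
          unfolding d_def power2_norm_eq_inner
          by (simp add: inner_add_right inner_diff_left inner_diff_right inner_commute)
        also have "(\<epsilon> s - \<epsilon> t) / 2 * ((- d) \<bullet> (xt t + xt s)) \<le> (\<epsilon> s - \<epsilon> t) / 2 * (\<kappa> t * (2 * X))"
        proof (intro mult_left_mono)
          have "(- d) \<bullet> (xt t + xt s) \<le> norm (- d) * norm (xt t + xt s)" by (rule norm_cauchy_schwarz)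
          also have "\<dots> \<le> \<kappa> t * (2 * X)"
            using d norm_triangle_ineq[of "xt t" "xt s"] norm_xt_le[OF t] norm_xt_le[OF s] 
            by (intro mult_mono) (auto intro: order_trans[OF norm_ge_zero])
          finally show "(- d) \<bullet> (xt t + xt s) \<le> \<kappa> t * (2 * X)" .
        qed (use de in simp)
        also have "(\<epsilon> s - \<epsilon> t) / 2 * (\<kappa> t * (2 * X)) = (\<epsilon> s - \<epsilon> t) * X * \<kappa> t" by simp
        finally show ?thesis .
      qed
      have eq: "x t - xt t = (x t - xt s) + 1 *\<^sub>R d" by (simp add: d_def)
      have 2: "(norm (x t - xt t))\<^sup>2 \<le> (norm (x t - xt s))\<^sup>2 + 2 * \<kappa> t * norm (x t - xt s) + (\<kappa> t)\<^sup>2"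
        unfolding eq using sq[of 1 "x t - xt s"] by simp
      have eqW: "(\<alpha> / 4) *\<^sub>R (x t - xt t) + (t powr q) *\<^sub>R v t = W t + (\<alpha> / 4) *\<^sub>R d"
        by (simp add: d_def W_def algebra_simps)
      have 3: "(norm ((\<alpha> / 4) *\<^sub>R (x t - xt t) + (t powr q) *\<^sub>R v t))\<^sup>2
          \<le> (norm (W t))\<^sup>2 + 2 * (\<alpha> / 4) * \<kappa> t * norm (W t) + (\<alpha> / 4)\<^sup>2 * (\<kappa> t)\<^sup>2"
        unfolding eqW using sq[of "\<alpha> / 4" "W t"] alpha_pos by simp
      have k1: "(t powr q)\<^sup>2 * (tikhonov g (\<epsilon> t) (xt s) - tikhonov g (\<epsilon> t) (xt t)) \<le> (t powr q)\<^sup>2 * ((\<epsilon> s - \<epsilon> t) * X * \<kappa> t)"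
        by (intro mult_left_mono 1) simp
      have k2: "3 * \<alpha>\<^sup>2 / 32 * (norm (x t - xt t))\<^sup>2 \<le> 3 * \<alpha>\<^sup>2 / 32 * ((norm (x t - xt s))\<^sup>2 + 2 * \<kappa> t * norm (x t - xt s) + (\<kappa> t)\<^sup>2)"
        by (intro mult_left_mono 2) simp
      have e1: "energy t = energy_at (xt s) t + (t powr q)\<^sup>2 * (tikhonov g (\<epsilon> t) (xt s) - tikhonov g (\<epsilon> t) (xt t))
         + ((norm ((\<alpha> / 4) *\<^sub>R (x t - xt t) + (t powr q) *\<^sub>R v t))\<^sup>2 - (norm (W t))\<^sup>2) / 2
         + 3 * \<alpha>\<^sup>2 / 32 * (norm (x t - xt t))\<^sup>2 - 3 * \<alpha>\<^sup>2 / 32 * (norm (x t - xt s))\<^sup>2"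
        unfolding energy_def energy_at_def W_def by (simp add: right_diff_distrib diff_divide_distrib)
      have e2: "\<kappa> t * N t = (t powr q)\<^sup>2 * ((\<epsilon> s - \<epsilon> t) * X * \<kappa> t)
         + (2 * (\<alpha> / 4) * \<kappa> t * norm (W t) + (\<alpha> / 4)\<^sup>2 * (\<kappa> t)\<^sup>2) / 2
         + 3 * \<alpha>\<^sup>2 / 32 * ((norm (x t - xt s))\<^sup>2 + 2 * \<kappa> t * norm (x t - xt s) + (\<kappa> t)\<^sup>2) - 3 * \<alpha>\<^sup>2 / 32 * (norm (x t - xt s))\<^sup>2"
        unfolding N_def by (simp add: field_simps power2_eq_square)
      show ?case unfolding e1 e2 using k1 k2 3 by argo
    qed
  qed
  then show ?thesis by (simp add: N_def \<kappa>s W_def)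
qed

section \<open>Continuity along the trajectory\<close>

lemma G_continuous: "continuous_on S G"
proof (rule continuous_at_imp_continuous_on, rule ballI)
  fix z
  obtain L where "L-lipschitz_on (ball z 1) G" using grad_lipschitz[OF bounded_ball] by blast
  then have "continuous_on (ball z 1) G" by (rule lipschitz_on_continuous_on)
  then show "isCont G z" by (simp add: continuous_on_eq_continuous_at)
qed

lemma xt_continuous: "continuous_on {t0..} xt"
  unfolding continuous_on_def
proof
  fix s assume s: "s \<in> {t0..}"
  have ec: "(\<epsilon> \<longlongrightarrow> \<epsilon> s) (at s within {t0..})"
    using DERIV_continuous[OF eps_deriv[of s]] s by (auto simp: continuous_within)
  have "((\<lambda>t. xt t - xt s) \<longlongrightarrow> 0) (at s within {t0..})"
  proof (rule Lim_null_comparison)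
    show "((\<lambda>t. 2 * X * \<bar>\<epsilon> s - \<epsilon> t\<bar> / (\<epsilon> t + \<epsilon> s)) \<longlongrightarrow> 0) (at s within {t0..})"
      using eps_pos[of s] s by (auto intro!: tendsto_eq_intros ec)
    show "\<forall>\<^sub>F t in at s within {t0..}. norm (xt t - xt s) \<le> 2 * X * \<bar>\<epsilon> s - \<epsilon> t\<bar> / (\<epsilon> t + \<epsilon> s)"
      unfolding eventually_at_filter xt_def X_def
      using x_min_lipschitz[OF eps_pos eps_pos min_norm_element_argmin, of _ s] s
      by (auto intro!: always_eventually)
  qed
  then show "(xt \<longlongrightarrow> xt s) (at s within {t0..})" by (rule LIM_zero_cancel)
qed

lemma continuous_facts:
  shows x_continuous: "continuous_on {t0..} x"
    and v_continuous: "continuous_on {t0..} v"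
    and eps_continuous: "continuous_on {t0..} \<epsilon>"
    and b_continuous: "continuous_on {t0..} b"
    and y_continuous: "continuous_on {t0..} y"
  by (auto simp: continuous_on_eq_continuous_within
      intro!: has_vector_derivative_continuous x_deriv v_deriv y_deriv DERIV_continuous eps_deriv b_deriv)

lemma powr_continuous: "continuous_on {t0..} (\<lambda>t. t powr p)" for p :: real
  by (intro continuous_on_powr continuous_on_id continuous_on_const) (use t0_pos in auto)

lemma A_continuous: "continuous_on {t0..} A"
  unfolding A_def
  by (intro continuous_intros continuous_on_compose2[OF G_continuous y_continuous] x_continuous eps_continuous) auto

lemma gap_continuous: "continuous_on {t0..} gap"
  unfolding gap_def tikhonov_def
  by (intro continuous_intros continuous_on_compose2[OF g_continuous] y_continuous xt_continuous eps_continuous) auto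

lemma energy_continuous: "continuous_on {t0..} energy"
proof -
  have "continuous_on {t0..} (\<lambda>t. (t powr q)\<^sup>2 * gap t
     + (norm ((\<alpha> / 4) *\<^sub>R (x t - xt t) + (t powr q) *\<^sub>R v t))\<^sup>2 / 2
     + 3 * \<alpha>\<^sup>2 / 32 * (norm (x t - xt t))\<^sup>2)"
    by (intro continuous_intros powr_continuous gap_continuous x_continuous xt_continuous v_continuous) auto
  then show ?thesis by (simp add: energy_def[abs_def] energy_at_def gap_def)
qed

lemma dissipation_continuous: "continuous_on {t0..} dissipation"
proof -
  have "continuous_on {t0..} (\<lambda>t. \<alpha> / 8 * t powr q * gap t + \<alpha> / 16 * t powr q * \<epsilon> t * (norm (x t - xt t))\<^sup>2
     + \<alpha> / 16 * t powr q * (norm (v t))\<^sup>2 + (1 / 2 * b t) * (t powr q)\<^sup>2 * (norm (A t))\<^sup>2)"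
    by (intro continuous_on_add continuous_on_mult continuous_on_power continuous_on_norm continuous_on_diff
        powr_continuous gap_continuous x_continuous xt_continuous v_continuous A_continuous b_continuous
        eps_continuous continuous_on_const)
  then show ?thesis by (simp add: dissipation_def[abs_def])
qed

text \<open>The inner products are expanded into the shape of the left side of
  \<open>dissipation_inequality\<close>, with \<open>- \<epsilon>' t\<close> for \<open>e'\<close>
  and \<open>t powr (q - 1)\<close> for \<tau>.\<close>

lemma energy_at_deriv_eq:
  assumes t: "t \<ge> t0"
  shows "energy_at_deriv (xt t) t
   = 2 * q * t powr (q - 1) * t powr q * gap t
      + (t powr q)\<^sup>2 * (m t * (v t \<bullet> A t) - b t * (norm (A t))\<^sup>2 + \<epsilon> t * b t * m t * (norm (v t))\<^sup>2
          - \<epsilon> t * (b t)\<^sup>2 * (v t \<bullet> A t) - (- \<epsilon>' t) / 2 * ((norm (y t))\<^sup>2 - (norm (xt t))\<^sup>2))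
      + (\<alpha> / 4 * (\<alpha> / 4 - \<alpha> + q * t powr (q - 1)) * ((x t - xt t) \<bullet> v t) - \<alpha> / 4 * t powr q * ((x t - xt t) \<bullet> A t)
         + t powr q * (\<alpha> / 4 - \<alpha> + q * t powr (q - 1)) * (norm (v t))\<^sup>2 - (t powr q)\<^sup>2 * (v t \<bullet> A t))
      + 3 * \<alpha>\<^sup>2 / 16 * ((x t - xt t) \<bullet> v t)"
proof -
  have 1: "(m1 *\<^sub>R v1 - b1 *\<^sub>R A1) \<bullet> (A1 + (e1 * b1) *\<^sub>R v1)
     = m1 * (v1 \<bullet> A1) - b1 * (norm A1)\<^sup>2 + e1 * b1 * m1 * (norm v1)\<^sup>2 - e1 * b1\<^sup>2 * (v1 \<bullet> A1)" for m1 b1 e1 and v1 A1 :: 'a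
    unfolding power2_norm_eq_inner
    by (simp add: inner_add_left inner_add_right inner_diff_left inner_commute[of A1 v1] power2_eq_square algebra_simps)
  have 2: "(c *\<^sub>R p1 + T *\<^sub>R v1) \<bullet> (k *\<^sub>R v1 - T *\<^sub>R A1)
     = c * k * (p1 \<bullet> v1) - c * T * (p1 \<bullet> A1) + T * k * (norm v1)\<^sup>2 - T\<^sup>2 * (v1 \<bullet> A1)" for c T k and p1 v1 A1 :: 'a
    unfolding power2_norm_eq_inner
    by (simp add: inner_add_left inner_diff_right power2_eq_square algebra_simps)
  show ?thesis unfolding energy_at_deriv_def gap_def[symmetric] 1 2 by simp
qed

text \<open>Strong convexity of \<open>tikhonov g (\<epsilon> t)\<close> between \<open>y t\<close>
  and \<open>xt t\<close>, expanded with
  \<open>y t - xt t = (x t - xt t) + b t *\<^sub>R v t\<close>; the terms in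
  \<open>(x t - xt t) \<bullet> v t\<close> cancel. It serves as hypothesis \<open>conv\<close> of
  \<open>dissipation_inequality\<close>.\<close>

lemma gap_convexity:
  assumes t: "t \<ge> t0"
  shows "(x t - xt t) \<bullet> A t + b t * (v t \<bullet> A t) + \<epsilon> t * (b t)\<^sup>2 * (norm (v t))\<^sup>2
    \<ge> gap t + \<epsilon> t / 2 * (norm (x t - xt t))\<^sup>2 + \<epsilon> t / 2 * (b t)\<^sup>2 * (norm (v t))\<^sup>2"
proof -
  have "g (xt t) \<ge> g (y t) + G (y t) \<bullet> (xt t - y t)" by (rule gradient_inequality)
  moreover have "(norm (y t))\<^sup>2 - (norm (xt t))\<^sup>2 + (norm (y t - xt t))\<^sup>2 = 2 * (y t \<bullet> (y t - xt t))"
    unfolding power2_norm_eq_inner by (simp add: inner_diff_left inner_diff_right inner_commute)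
  then have "\<epsilon> t / 2 * ((norm (y t))\<^sup>2 - (norm (xt t))\<^sup>2 + (norm (y t - xt t))\<^sup>2) = \<epsilon> t * (y t \<bullet> (y t - xt t))"
    by simp
  ultimately have 1: "gap t + \<epsilon> t / 2 * (norm (y t - xt t))\<^sup>2 \<le> (G (y t) + \<epsilon> t *\<^sub>R y t) \<bullet> (y t - xt t)"
    unfolding gap_def tikhonov_def
    by (simp add: inner_add_left inner_diff_right algebra_simps)
  have yA: "G (y t) + \<epsilon> t *\<^sub>R y t = A t + (\<epsilon> t * b t) *\<^sub>R v t"
    by (simp add: A_def y_def scaleR_add_right)
  have y: "y t - xt t = (x t - xt t) + b t *\<^sub>R v t" by (simp add: y_def)
  have "(norm (y t - xt t))\<^sup>2 = (norm (x t - xt t))\<^sup>2 + 2 * b t * ((x t - xt t) \<bullet> v t) + (b t)\<^sup>2 * (norm (v t))\<^sup>2"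
    unfolding y power2_norm_eq_inner
    by (simp only: inner_add_left inner_add_right inner_scaleR_left inner_scaleR_right inner_commute[of "v t" "x t - xt t"] power2_eq_square)
       (simp add: algebra_simps)
  moreover have "(A t + (\<epsilon> t * b t) *\<^sub>R v t) \<bullet> (y t - xt t) = (x t - xt t) \<bullet> A t + b t * (v t \<bullet> A t)
      + \<epsilon> t * b t * ((x t - xt t) \<bullet> v t) + \<epsilon> t * (b t)\<^sup>2 * (norm (v t))\<^sup>2"
    unfolding y power2_norm_eq_inner
    by (simp only: inner_add_left inner_add_right inner_scaleR_left inner_scaleR_right
        inner_commute[of "A t"] inner_commute[of "v t" "x t - xt t"] power2_eq_square) (simp add: algebra_simps)
  ultimately show ?thesis using 1 unfolding yA by (simp add: field_simps)
qed

section \<open>Asymptotic size of the coefficients\<close>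

lemma b_lim: "(b \<longlongrightarrow> \<gamma>) at_top"
proof -
  have "((\<lambda>t. \<beta> / t powr q) \<longlongrightarrow> 0) at_top" using q_pos by real_asymp
  from tendsto_add[OF tendsto_const[of \<gamma>] this] show ?thesis by (simp add: beta_coeff_def[abs_def])
qed

lemma b_eventually_pos: "\<forall>\<^sub>F t in at_top. b t > 0"
proof (cases "\<gamma> > 0")
  case True
  then show ?thesis by (rule order_tendstoD(1)[OF b_lim])
next
  case False
  then have g0: "\<gamma> = 0" "\<beta> > 0" using gamma_beta by auto
  show ?thesis using eventually_gt_at_top[of 0]
    by eventually_elim (simp add: beta_coeff_def g0)
qed

lemma m_lim: "(m \<longlongrightarrow> 1) at_top"
proof -
  have 1: "((\<lambda>t. q * \<beta> * t powr (- q - 1)) \<longlongrightarrow> 0) at_top" using q_pos by real_asymp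
  have "((\<lambda>t. \<alpha> / t powr q) \<longlongrightarrow> 0) at_top" using q_pos by real_asymp
  from tendsto_mult[OF this b_lim] have 2: "((\<lambda>t. \<alpha> * b t / t powr q) \<longlongrightarrow> 0) at_top"
    by (simp add: field_simps)
  from tendsto_diff[OF tendsto_diff[OF tendsto_const[of 1] 1] 2] show ?thesis by (simp add: m_def[abs_def])
qed

text \<open>(C2) bounds \<open>\<epsilon> t * t powr q\<close> by \<alpha>/(2 \<gamma>), and
  \<open>b t\<close> is eventually below 17/16 of \<gamma>. For \<gamma> = 0 the product is
  \<open>\<epsilon> t * \<beta>\<close>, which tends to 0.\<close>

lemma eventually_eps_b: "\<forall>\<^sub>F t in at_top. \<epsilon> t * t powr q * b t \<le> 17 / 32 * \<alpha>"
proof (cases "\<gamma> > 0")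
  case True
  have "\<forall>\<^sub>F t in at_top. b t < 17 / 16 * \<gamma>" by (rule order_tendstoD(2)[OF b_lim]) (use True in simp)
  moreover have "\<forall>\<^sub>F t in at_top. \<epsilon> t \<le> \<alpha> / (2 * \<gamma> * t powr q)" using C2 True by simp
  ultimately show ?thesis using b_eventually_pos eventually_gt_at_top[of 0]
  proof eventually_elim
    case (elim t)
    have "\<epsilon> t * t powr q * b t \<le> \<alpha> / (2 * \<gamma> * t powr q) * t powr q * b t"
      using elim by (intro mult_right_mono) auto
    also have "\<dots> = \<alpha> / (2 * \<gamma>) * b t" using elim by simp
    also have "\<dots> \<le> \<alpha> / (2 * \<gamma>) * (17 / 16 * \<gamma>)"
      using elim True alpha_pos by (intro mult_left_mono) auto
    also have "\<dots> = 17 / 32 * \<alpha>" using True by simp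
    finally show ?case .
  qed
next
  case False
  then have gb: "\<gamma> = 0" "\<beta> > 0" using gamma_beta by auto
  have "((\<lambda>t. \<epsilon> t * \<beta>) \<longlongrightarrow> 0 * \<beta>) at_top" by (intro tendsto_mult eps_lim tendsto_const)
  then have "\<forall>\<^sub>F t in at_top. \<epsilon> t * \<beta> < 17 / 32 * \<alpha>" by (rule order_tendstoD(2)) (use alpha_pos in simp)
  then show ?thesis using eventually_gt_at_top[of 0]
    by eventually_elim (simp add: beta_coeff_def gb)
qed

text \<open>The denominator forces the case distinction: for \<gamma> = 0 also \<open>b t\<close>
  tends to 0, but then \<open>b t * (t powr q) ^ 3\<close> is
  \<open>\<beta> * (t powr q)\<^sup>2\<close>.\<close>

lemma eventually_small_coefficient:
  "\<forall>\<^sub>F t in at_top. q\<^sup>2 * \<beta>\<^sup>2 * (t powr (q - 1))\<^sup>2 / (b t * (t powr q) ^ 3) + 4 * \<alpha>\<^sup>2 * (b t / t powr q) \<le> \<alpha> / 60"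
proof -
  have "((\<lambda>t. 4 * \<alpha>\<^sup>2 / t powr q) \<longlongrightarrow> 0) at_top" using q_pos by real_asymp
  from tendsto_mult[OF this b_lim] have 2: "((\<lambda>t. 4 * \<alpha>\<^sup>2 * (b t / t powr q)) \<longlongrightarrow> 0) at_top"
    by (simp add: field_simps)
  have 1: "((\<lambda>t. q\<^sup>2 * \<beta>\<^sup>2 * (t powr (q - 1))\<^sup>2 / (b t * (t powr q) ^ 3)) \<longlongrightarrow> 0) at_top"
  proof (cases "\<gamma> > 0")
    case True
    have "((\<lambda>t. q\<^sup>2 * \<beta>\<^sup>2 * (t powr (q - 1))\<^sup>2 / (t powr q) ^ 3) \<longlongrightarrow> 0) at_top"
      using q_pos q_less_1 by real_asymp
    from tendsto_divide[OF this b_lim] show ?thesis using True by (simp add: mult_ac)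
  next
    case False
    then have gb: "\<gamma> = 0" "\<beta> > 0" using gamma_beta by auto
    have "((\<lambda>t. q\<^sup>2 * \<beta> * (t powr (q - 1))\<^sup>2 / (t powr q)\<^sup>2) \<longlongrightarrow> 0) at_top"
      using q_pos q_less_1 by real_asymp
    moreover have "\<forall>\<^sub>F t in at_top. q\<^sup>2 * \<beta> * (t powr (q - 1))\<^sup>2 / (t powr q)\<^sup>2
        = q\<^sup>2 * \<beta>\<^sup>2 * (t powr (q - 1))\<^sup>2 / (b t * (t powr q) ^ 3)"
      using eventually_gt_at_top[of 0]
      by eventually_elim (use gb in \<open>simp add: beta_coeff_def power2_eq_square power3_eq_cube\<close>)
    ultimately show ?thesis by (rule Lim_transform_eventually)
  qed
  have "\<forall>\<^sub>F t in at_top. q\<^sup>2 * \<beta>\<^sup>2 * (t powr (q - 1))\<^sup>2 / (b t * (t powr q) ^ 3) + 4 * \<alpha>\<^sup>2 * (b t / t powr q) < \<alpha> / 60"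
    by (rule order_tendstoD(2)[OF tendsto_add[OF 1 2]]) (use alpha_pos in simp)
  then show ?thesis by (rule eventually_mono) simp
qed

text \<open>The first summand pays for the decrease of \<epsilon> in the gap, the second for the
  motion of \<open>xt\<close>.\<close>

definition source :: "real \<Rightarrow> real" where
  "source t = \<epsilon> t * t powr (2 * q - 1) + t powr (r - 2)"

lemma source_continuous: "continuous_on {t0..} source"
  unfolding source_def by (intro continuous_intros powr_continuous eps_continuous)

lemma source_pos: "t \<ge> t0 \<Longrightarrow> source t > 0"
  unfolding source_def using eps_pos[of t] t0_pos by (intro add_pos_pos) auto

text \<open>The square root of (C3) bounds the logarithmic derivative of \<epsilon> by a multiple of
  1/t.\<close>

lemma C1_C3_constants:
  obtains K1 K where "K1 > 0" "K > 0" "\<forall>\<^sub>F t in at_top. \<epsilon> t \<ge> K1 / t powr (r + q)"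
    "\<forall>\<^sub>F t in at_top. - \<epsilon>' t \<le> K * \<epsilon> t / t"
proof -
  obtain K1 where K1: "K1 > 0" "\<forall>\<^sub>F t in at_top. \<epsilon> t \<ge> K1 / t powr (r + q)" using C1 by blast
  obtain K3 where K3: "K3 > 0" "\<forall>\<^sub>F t in at_top. (\<epsilon>' t / \<epsilon> t)\<^sup>2 \<le> K3 / t\<^sup>2" using C3 by blast
  have "\<forall>\<^sub>F t in at_top. - \<epsilon>' t \<le> sqrt K3 * \<epsilon> t / t"
    using K3(2) eventually_ge_at_top[of t0]
  proof eventually_elim
    case (elim t)
    have e: "\<epsilon> t > 0" "t > 0" using eps_pos elim t0_pos by auto
    have "(\<epsilon>' t / \<epsilon> t)\<^sup>2 \<le> (sqrt K3 / t)\<^sup>2" using elim K3 by (simp add: power_divide)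
    then have "\<bar>\<epsilon>' t / \<epsilon> t\<bar> \<le> sqrt K3 / t" 
      using e K3 by (subst power2_le_iff_abs_le[symmetric]) simp_all
    then have "- (\<epsilon>' t / \<epsilon> t) \<le> sqrt K3 / t" by linarith
    then show ?case using e by (simp add: field_simps)
  qed
  with K1 K3(1) show ?thesis by (intro that[of K1 "sqrt K3"]) auto
qed

lemma X_nonneg: "X \<ge> 0" by (simp add: X_def)

text \<open>\<open>dissipation_inequality\<close> is applied to the bound of
  \<open>energy_dini\<close>. (C3) makes \<open>\<kappa>\<close> of order 1/s, and (C1) then turns
  the Young remainder \<open>\<kappa>\<^sup>2 / (T * \<epsilon> s)\<close> into
  \<open>s powr (r - 2)\<close>.\<close>

lemma energy_dissipation:
  obtains C where "C > 0" "\<forall>\<^sub>F s in at_top. dini_le energy s (C * source s - dissipation s)"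
proof -
  obtain K1 K where K: "K1 > 0" "K > 0" and e1: "\<forall>\<^sub>F t in at_top. \<epsilon> t \<ge> K1 / t powr (r + q)"
    and e2: "\<forall>\<^sub>F t in at_top. - \<epsilon>' t \<le> K * \<epsilon> t / t" using C1_C3_constants by blast
  \<comment> \<open>One summand for each error term of \<open>dissipation_inequality\<close>; the 1
    keeps \<open>C\<close> positive when \<open>X = 0\<close>.\<close>
  define C where "C = K * X\<^sup>2 / 2 + \<alpha> ^ 3 / 2 * X\<^sup>2 * K\<^sup>2 / K1 + \<alpha> / 2 * X\<^sup>2 * K\<^sup>2 + 1"
  have f3: "\<forall>\<^sub>F t in at_top. 2 * q * t powr (q - 1) \<le> \<alpha> / 8" using q_less_1 alpha_pos by real_asymp
  have f7: "\<forall>\<^sub>F t in at_top. q * t powr (q - 1) \<le> \<alpha> / 60" using q_less_1 alpha_pos by real_asymp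
  \<comment> \<open>The exponents satisfy \<open>2 * q - 2 < q - r\<close>, because \<open>q\<close>
    and \<open>r\<close> are below 1.\<close>
  have f9: "\<forall>\<^sub>F t in at_top. 16 * q\<^sup>2 * (t powr (q - 1))\<^sup>2 \<le> (t powr q)\<^sup>2 * (K1 / t powr (r + q))"
    using K q_less_1 r_bounds by real_asymp
  have f5: "\<forall>\<^sub>F t in at_top. m t < 17 / 16" by (rule order_tendstoD(2)[OF m_lim]) simp
  have "((\<lambda>t. \<alpha> / 4 * \<epsilon> t * (b t)\<^sup>2 / 2) \<longlongrightarrow> \<alpha> / 4 * 0 * \<gamma>\<^sup>2 / 2) at_top"
    by (intro tendsto_intros eps_lim b_lim) simp
  then have f6: "\<forall>\<^sub>F t in at_top. \<alpha> / 4 * \<epsilon> t * (b t)\<^sup>2 / 2 < \<alpha> / 60"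
    by (rule order_tendstoD(2)) (use alpha_pos in simp)
  have "\<forall>\<^sub>F s in at_top. dini_le energy s (C * source s - dissipation s)"
    using e1 e2 f3 f7 f9 f5 f6 eventually_ge_at_top[of "max t0 1"] b_eventually_pos eventually_eps_b eventually_small_coefficient
  proof eventually_elim
    case (elim s)
    have s: "s \<ge> t0" "s \<ge> 1" "s > 0" using elim(8) by auto
    define T where "T = s powr q"
    define \<kappa> where "\<kappa> = X * (- \<epsilon>' s) / \<epsilon> s"
    have e: "\<epsilon> s > 0" "\<epsilon>' s \<le> 0" using eps_pos eps'_nonpos s by auto
    have T: "T > 0" using s by (simp add: T_def)
    have \<kappa>0: "\<kappa> \<ge> 0" unfolding \<kappa>_def using e X_nonneg by (intro divide_nonneg_pos mult_nonneg_nonneg) auto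
    have "- \<epsilon>' s / \<epsilon> s \<le> K / s" using elim(2) e s by (simp add: field_simps)
    then have "X * (- \<epsilon>' s / \<epsilon> s) \<le> X * (K / s)" by (rule mult_left_mono) (rule X_nonneg)
    then have \<kappa>: "\<kappa> \<le> X * K / s" by (simp add: \<kappa>_def)
    have \<kappa>2: "\<kappa>\<^sup>2 \<le> X\<^sup>2 * K\<^sup>2 / s\<^sup>2"
      using power_mono[OF \<kappa> \<kappa>0, of 2] by (simp add: power_divide power_mult_distrib)
    have Tr: "T / s powr (r + q) = s powr (- r)"
      unfolding T_def using s by (simp add: powr_diff[symmetric])
    have eT: "K1 * s powr (- r) \<le> T * \<epsilon> s"
      using mult_left_mono[OF elim(1), of T] T unfolding Tr[symmetric] by (simp add: mult.commute)
    let ?h = "energy_at_deriv (xt s) s + \<kappa> * (\<alpha> / 4 * norm ((\<alpha> / 4) *\<^sub>R (x s - xt s) + T *\<^sub>R v s)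
        + 3 * \<alpha>\<^sup>2 / 16 * norm (x s - xt s))"
    have "?h \<le> - (\<alpha> / 8 * T * gap s + \<alpha> / 16 * T * \<epsilon> s * (norm (x s - xt s))\<^sup>2
          + \<alpha> / 16 * T * (norm (v s))\<^sup>2 + b s / 2 * T\<^sup>2 * (norm (A s))\<^sup>2)
        + (T\<^sup>2 * (- \<epsilon>' s) * X\<^sup>2 / 2 + \<alpha> ^ 3 / 2 * \<kappa>\<^sup>2 / (T * \<epsilon> s) + \<alpha> / 2 * T * \<kappa>\<^sup>2)"
      unfolding energy_at_deriv_eq[OF s(1)] T_def[symmetric]
    proof (rule dissipation_inequality[where \<beta> = \<beta>])
      show "\<bar>v s \<bullet> A s\<bar> \<le> norm (v s) * norm (A s)" "\<bar>(x s - xt s) \<bullet> v s\<bar> \<le> norm (x s - xt s) * norm (v s)"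
        by (rule Cauchy_Schwarz_ineq2)+
      show "(norm (xt s))\<^sup>2 \<le> X\<^sup>2" using norm_xt_le[OF s(1)] by (intro power_mono) auto
      show "norm ((\<alpha> / 4) *\<^sub>R (x s - xt s) + T *\<^sub>R v s) \<le> \<alpha> / 4 * norm (x s - xt s) + T * norm (v s)"
        using norm_triangle_ineq[of "(\<alpha> / 4) *\<^sub>R (x s - xt s)" "T *\<^sub>R v s"] alpha_pos T by simp
      have "T\<^sup>2 * s powr (- q - 1) = s powr (q - 1)"
        unfolding T_def power2_eq_square using s by (simp add: powr_add[symmetric])
      moreover have "T\<^sup>2 / T = T" using T by (simp add: power2_eq_square)
      moreover have "T\<^sup>2 * (m s - 1) = - q * \<beta> * (T\<^sup>2 * s powr (- q - 1)) - \<alpha> * b s * (T\<^sup>2 / T)"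
        by (simp add: m_def T_def algebra_simps)
      ultimately show "T\<^sup>2 * (m s - 1) = - q * \<beta> * s powr (q - 1) - \<alpha> * b s * T" by simp
      show "16 * q\<^sup>2 * (s powr (q - 1))\<^sup>2 \<le> T\<^sup>2 * \<epsilon> s"
        using elim(5) mult_left_mono[OF elim(1), of "T\<^sup>2"] by (simp add: T_def)
      show "gap s + \<epsilon> s / 2 * (norm (x s - xt s))\<^sup>2 + \<epsilon> s / 2 * (b s)\<^sup>2 * (norm (v s))\<^sup>2
        \<le> (x s - xt s) \<bullet> A s + b s * (v s \<bullet> A s) + \<epsilon> s * (b s)\<^sup>2 * (norm (v s))\<^sup>2"
        by (rule gap_convexity[OF s(1)])
    qed (use elim e \<kappa>0 T gap_nonneg[OF s(1)] alpha_pos q_pos in \<open>auto simp: T_def\<close>)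
    also have "T\<^sup>2 * (- \<epsilon>' s) * X\<^sup>2 / 2 \<le> K * X\<^sup>2 / 2 * (\<epsilon> s * s powr (2 * q - 1))"
    proof -
      have "T\<^sup>2 * X\<^sup>2 / 2 * (- \<epsilon>' s) \<le> T\<^sup>2 * X\<^sup>2 / 2 * (K * \<epsilon> s / s)" by (intro mult_left_mono elim) simp
      moreover have ts: "T\<^sup>2 / s = s powr (2 * q - 1)"
        unfolding T_def power2_eq_square using s by (simp add: powr_add[symmetric] powr_diff)
      ultimately show ?thesis unfolding ts[symmetric] by (simp add: mult_ac)
    qed
    also have "\<alpha> ^ 3 / 2 * \<kappa>\<^sup>2 / (T * \<epsilon> s) \<le> \<alpha> ^ 3 / 2 * X\<^sup>2 * K\<^sup>2 / K1 * s powr (r - 2)"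
    proof -
      have "\<alpha> ^ 3 / 2 * \<kappa>\<^sup>2 / (T * \<epsilon> s) \<le> \<alpha> ^ 3 / 2 * (X\<^sup>2 * K\<^sup>2 / s\<^sup>2) / (K1 * s powr (- r))"
        using alpha_pos K s by (intro frac_le mult_left_mono \<kappa>2 eT) auto
      also have "\<dots> = \<alpha> ^ 3 / 2 * X\<^sup>2 * K\<^sup>2 / K1 * s powr (r - 2)"
        using s K by (simp add: powr_diff powr_minus field_simps)
      finally show ?thesis .
    qed
    also have "\<alpha> / 2 * T * \<kappa>\<^sup>2 \<le> \<alpha> / 2 * X\<^sup>2 * K\<^sup>2 * s powr (r - 2)"
    proof -
      have "\<alpha> / 2 * T * \<kappa>\<^sup>2 \<le> \<alpha> / 2 * T * (X\<^sup>2 * K\<^sup>2 / s\<^sup>2)" using alpha_pos T by (intro mult_left_mono \<kappa>2) auto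
      also have "\<dots> = \<alpha> / 2 * X\<^sup>2 * K\<^sup>2 * s powr (q - 2)" using s by (simp add: T_def powr_diff)
      also have "\<dots> \<le> \<alpha> / 2 * X\<^sup>2 * K\<^sup>2 * s powr (r - 2)"
        using alpha_pos s r_bounds by (intro mult_left_mono powr_mono) auto
      finally show ?thesis .
    qed
    finally have "?h \<le> - dissipation s + (K * X\<^sup>2 / 2 * (\<epsilon> s * s powr (2 * q - 1))
        + \<alpha> ^ 3 / 2 * X\<^sup>2 * K\<^sup>2 / K1 * s powr (r - 2) + \<alpha> / 2 * X\<^sup>2 * K\<^sup>2 * s powr (r - 2))"
      by (simp add: dissipation_def T_def)
    also have "\<dots> \<le> - dissipation s + C * source s"
    proof -
      have n: "0 \<le> \<epsilon> s * s powr (2 * q - 1)" "0 \<le> s powr (r - 2)" using e by auto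
      have c: "0 \<le> K * X\<^sup>2 / 2" "0 \<le> \<alpha> ^ 3 / 2 * X\<^sup>2 * K\<^sup>2 / K1" "0 \<le> \<alpha> / 2 * X\<^sup>2 * K\<^sup>2"
        using K alpha_pos by auto
      have "K * X\<^sup>2 / 2 * (\<epsilon> s * s powr (2 * q - 1)) \<le> C * (\<epsilon> s * s powr (2 * q - 1))"
        using c by (intro mult_right_mono n) (simp add: C_def)
      moreover have "(\<alpha> ^ 3 / 2 * X\<^sup>2 * K\<^sup>2 / K1 + \<alpha> / 2 * X\<^sup>2 * K\<^sup>2) * s powr (r - 2) \<le> C * s powr (r - 2)"
        using c by (intro mult_right_mono n) (simp add: C_def)
      ultimately show ?thesis unfolding source_def by (simp add: algebra_simps)
    qed
    finally have "?h \<le> C * source s - dissipation s" by simp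
    with energy_dini[OF s(1)] show ?case unfolding \<kappa>_def T_def by (rule dini_le_mono)
  qed
  moreover have "C > 0"
    unfolding C_def using K alpha_pos by (intro add_nonneg_pos add_nonneg_nonneg) auto
  ultimately show ?thesis by (rule that[rotated])
qed

section \<open>Rates, strong convergence and integral estimates\<close>

text \<open>The level, up to a constant, at which the decay \<open>t powr (- r) * energy t\<close>
  balances \<open>source t\<close>.\<close>

definition rate :: "real \<Rightarrow> real" where
  "rate t = \<epsilon> t * t powr (2 * q + r - 1) + t powr (2 * r - 2)"

lemma rate_eq:
  assumes "t > 0" shows "rate t = t powr r * source t"
proof -
  have "t powr r * t powr (2 * q - 1) = t powr (2 * q + r - 1)" "t powr r * t powr (r - 2) = t powr (2 * r - 2)"
    using assms by (simp_all add: powr_add[symmetric] algebra_simps)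
  then show ?thesis unfolding rate_def source_def by (simp add: distrib_left mult.left_commute)
qed

lemma rate_pos: "t \<ge> t0 \<Longrightarrow> rate t > 0"
  unfolding rate_def using eps_pos[of t] t0_pos by (intro add_pos_pos) auto

lemma rate_div:
  assumes "t > 0"
  shows "rate t / (t powr q)\<^sup>2 = t powr (2 * r - 2 * q - 2) + \<epsilon> t * t powr (r - 1)"
proof -
  have "(t powr q)\<^sup>2 = t powr (2 * q)" using assms by (simp add: power2_eq_square powr_add[symmetric])
  then have "t powr (2 * q + r - 1) / (t powr q)\<^sup>2 = t powr (r - 1)"
    "t powr (2 * r - 2) / (t powr q)\<^sup>2 = t powr (2 * r - 2 * q - 2)"
    using assms by (simp_all add: powr_diff[symmetric] algebra_simps)
  then show ?thesis
    unfolding rate_def by (simp add: add_divide_distrib flip: times_divide_eq_right)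
qed

lemma energy_eq: "energy t = (t powr q)\<^sup>2 * gap t
     + (norm ((\<alpha> / 4) *\<^sub>R (x t - xt t) + (t powr q) *\<^sub>R v t))\<^sup>2 / 2
     + 3 * \<alpha>\<^sup>2 / 32 * (norm (x t - xt t))\<^sup>2"
  by (simp add: energy_def energy_at_def gap_def)

lemma energy_nonneg: "t \<ge> t0 \<Longrightarrow> energy t \<ge> 0"
  unfolding energy_eq using gap_nonneg[of t] by (intro add_nonneg_nonneg) auto

lemma norm_add_power2_le: "(norm (u + w))\<^sup>2 \<le> 2 * (norm u)\<^sup>2 + 2 * (norm w)\<^sup>2" for u w :: 'a
proof -
  have "(norm (u + w))\<^sup>2 + (norm (u - w))\<^sup>2 = 2 * (norm u)\<^sup>2 + 2 * (norm w)\<^sup>2"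
    unfolding power2_norm_eq_inner
    by (simp add: inner_add_left inner_add_right inner_diff_left inner_diff_right)
  then show ?thesis using zero_le_power2[of "norm (u - w)"] by linarith
qed

lemma energy_lower_bounds:
  assumes t: "t \<ge> t0"
  shows "(t powr q)\<^sup>2 * gap t \<le> energy t"
    and "3 * \<alpha>\<^sup>2 / 32 * (norm (x t - xt t))\<^sup>2 \<le> energy t"
    and "(t powr q)\<^sup>2 * (norm (v t))\<^sup>2 \<le> 16 / 3 * energy t"
proof -
  let ?W = "(\<alpha> / 4) *\<^sub>R (x t - xt t) + (t powr q) *\<^sub>R v t"
  have n: "0 \<le> (t powr q)\<^sup>2 * gap t" "0 \<le> (norm ?W)\<^sup>2 / 2" "0 \<le> 3 * \<alpha>\<^sup>2 / 32 * (norm (x t - xt t))\<^sup>2"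
    using gap_nonneg[OF t] by auto
  show "(t powr q)\<^sup>2 * gap t \<le> energy t" "3 * \<alpha>\<^sup>2 / 32 * (norm (x t - xt t))\<^sup>2 \<le> energy t"
    unfolding energy_eq using n by linarith+
  \<comment> \<open>The scaled velocity is the difference of \<open>?W\<close> and
    \<open>(\<alpha> / 4) *\<^sub>R (x t - xt t)\<close>. The two weighted squares on the right are
    at most 4 and 4/3 times the energy, whence 16/3.\<close>
  have "(norm ((t powr q) *\<^sub>R v t))\<^sup>2 \<le> 2 * (norm ?W)\<^sup>2 + 2 * (norm ((\<alpha> / 4) *\<^sub>R (x t - xt t)))\<^sup>2"
    using norm_add_power2_le[of ?W "- ((\<alpha> / 4) *\<^sub>R (x t - xt t))"] by simp
  then have "(t powr q)\<^sup>2 * (norm (v t))\<^sup>2 \<le> 2 * (norm ?W)\<^sup>2 + \<alpha>\<^sup>2 / 8 * (norm (x t - xt t))\<^sup>2"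
    by (simp add: power_mult_distrib power_divide)
  also have "\<dots> \<le> 16 / 3 * energy t"
    unfolding energy_eq using n by argo
  finally show "(t powr q)\<^sup>2 * (norm (v t))\<^sup>2 \<le> 16 / 3 * energy t" .
qed

lemma energy_upper_bound:
  "energy t \<le> (t powr q)\<^sup>2 * gap t + (t powr q)\<^sup>2 * (norm (v t))\<^sup>2 + 5 * \<alpha>\<^sup>2 / 32 * (norm (x t - xt t))\<^sup>2"
proof -
  have "(norm ((\<alpha> / 4) *\<^sub>R (x t - xt t) + (t powr q) *\<^sub>R v t))\<^sup>2
    \<le> 2 * (\<alpha>\<^sup>2 / 16 * (norm (x t - xt t))\<^sup>2) + 2 * ((t powr q)\<^sup>2 * (norm (v t))\<^sup>2)"
    using norm_add_power2_le[of "(\<alpha> / 4) *\<^sub>R (x t - xt t)" "(t powr q) *\<^sub>R v t"]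
    by (simp add: power_mult_distrib power_divide)
  then show ?thesis unfolding energy_eq by (simp add: field_simps)
qed

lemma dissipation_terms:
  assumes t: "t \<ge> t0" "b t > 0"
  shows "\<alpha> / 8 * t powr q * gap t \<le> dissipation t"
    and "\<alpha> / 16 * t powr q * (norm (v t))\<^sup>2 \<le> dissipation t"
    and "b t / 2 * (t powr q)\<^sup>2 * (norm (A t))\<^sup>2 \<le> dissipation t"
    and "\<alpha> / 16 * t powr q * (gap t + \<epsilon> t * (norm (x t - xt t))\<^sup>2 + (norm (v t))\<^sup>2) \<le> dissipation t"
    and "0 \<le> dissipation t"
proof -
  have n: "0 \<le> \<alpha> / 8 * t powr q * gap t" "0 \<le> \<alpha> / 16 * t powr q * \<epsilon> t * (norm (x t - xt t))\<^sup>2"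
    "0 \<le> \<alpha> / 16 * t powr q * (norm (v t))\<^sup>2" "0 \<le> b t / 2 * (t powr q)\<^sup>2 * (norm (A t))\<^sup>2"
    using gap_nonneg[OF t(1)] t alpha_pos eps_pos[OF t(1)] by auto
  show "\<alpha> / 8 * t powr q * gap t \<le> dissipation t"
    "\<alpha> / 16 * t powr q * (norm (v t))\<^sup>2 \<le> dissipation t"
    "b t / 2 * (t powr q)\<^sup>2 * (norm (A t))\<^sup>2 \<le> dissipation t"
    "0 \<le> dissipation t"
    unfolding dissipation_def using n by linarith+
  have "\<alpha> / 16 * t powr q * (gap t + \<epsilon> t * (norm (x t - xt t))\<^sup>2 + (norm (v t))\<^sup>2)
    = \<alpha> / 8 * t powr q * gap t / 2 + \<alpha> / 16 * t powr q * \<epsilon> t * (norm (x t - xt t))\<^sup>2 + \<alpha> / 16 * t powr q * (norm (v t))\<^sup>2"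
    by (simp add: algebra_simps)
  then show "\<alpha> / 16 * t powr q * (gap t + \<epsilon> t * (norm (x t - xt t))\<^sup>2 + (norm (v t))\<^sup>2) \<le> dissipation t"
    unfolding dissipation_def using n by linarith
qed

text \<open>After multiplication by \<open>t powr (- r)\<close>, the gap and velocity parts of the
  energy fit under the dissipation because \<open>q < r\<close>, and the part in
  \<open>x t - xt t\<close> because (C1) bounds \<open>t powr q * \<epsilon> t\<close> below by
  \<open>K1 * t powr (- r)\<close>.\<close>

lemma energy_le_dissipation:
  obtains \<mu> where "\<mu> > 0" "\<forall>\<^sub>F t in at_top. \<mu> * t powr (- r) * energy t \<le> dissipation t"
proof -
  obtain K1 where K1: "K1 > 0" "\<forall>\<^sub>F t in at_top. \<epsilon> t \<ge> K1 / t powr (r + q)" using C1 by blast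
  \<comment> \<open>The minimum serves both comparisons: 1 for gap and velocity, the other entry for
    \<open>5 * \<alpha>\<^sup>2 / 32\<close> of \<open>energy_upper_bound\<close> against
    \<open>K1\<close>.\<close>
  define \<mu> where "\<mu> = \<alpha> / 16 * min 1 (32 * K1 / (5 * \<alpha>\<^sup>2))"
  have "\<forall>\<^sub>F t in at_top. \<mu> * t powr (- r) * energy t \<le> dissipation t"
    using K1(2) b_eventually_pos eventually_ge_at_top[of "max t0 1"]
  proof eventually_elim
    case (elim t)
    have t: "t \<ge> t0" "t \<ge> 1" using elim by auto
    let ?T = "t powr q"
    have TT: "t powr (- r) * ?T\<^sup>2 \<le> ?T"
    proof -
      have "t powr (- r) * ?T\<^sup>2 = t powr (2 * q - r)"
        using t by (simp add: power2_eq_square powr_add[symmetric])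
      also have "\<dots> \<le> ?T" using t r_bounds by (intro powr_mono) auto
      finally show ?thesis .
    qed
    have eT: "K1 * t powr (- r) \<le> ?T * \<epsilon> t"
    proof -
      have Tr: "?T / t powr (r + q) = t powr (- r)" using t by (simp add: powr_diff[symmetric])
      have "K1 * t powr (- r) = ?T * (K1 / t powr (r + q))" unfolding Tr[symmetric] by simp
      also have "\<dots> \<le> ?T * \<epsilon> t" by (intro mult_left_mono elim) simp
      finally show ?thesis .
    qed
    define k where "k = min 1 (32 * K1 / (5 * \<alpha>\<^sup>2))"
    have k: "0 < k" "k \<le> 1" "k * (5 * \<alpha>\<^sup>2 / 32) \<le> K1"
      using K1 alpha_pos by (auto simp: k_def min_def field_simps)
    have "k * t powr (- r) * energy t \<le> k * t powr (- r) * (?T\<^sup>2 * gap t + ?T\<^sup>2 * (norm (v t))\<^sup>2 + 5 * \<alpha>\<^sup>2 / 32 * (norm (x t - xt t))\<^sup>2)"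
      using k by (intro mult_left_mono energy_upper_bound) auto
    also have "\<dots> = k * (t powr (- r) * ?T\<^sup>2) * gap t + k * (t powr (- r) * ?T\<^sup>2) * (norm (v t))\<^sup>2
        + (k * (5 * \<alpha>\<^sup>2 / 32)) * t powr (- r) * (norm (x t - xt t))\<^sup>2"
      by (simp add: algebra_simps)
    also have "\<dots> \<le> 1 * ?T * gap t + 1 * ?T * (norm (v t))\<^sup>2 + ?T * \<epsilon> t * (norm (x t - xt t))\<^sup>2"
    proof (intro add_mono mult_right_mono mult_mono[OF k(2) TT])
      have "k * (5 * \<alpha>\<^sup>2 / 32) * t powr (- r) \<le> K1 * t powr (- r)" by (intro mult_right_mono k) simp
      then show "k * (5 * \<alpha>\<^sup>2 / 32) * t powr (- r) \<le> ?T * \<epsilon> t" using eT by simp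
    qed (use gap_nonneg[OF t(1)] in auto)
    finally have "\<alpha> / 16 * (k * t powr (- r) * energy t)
        \<le> \<alpha> / 16 * (1 * ?T * gap t + 1 * ?T * (norm (v t))\<^sup>2 + ?T * \<epsilon> t * (norm (x t - xt t))\<^sup>2)"
      using alpha_pos by (intro mult_left_mono) auto
    also have "\<dots> = \<alpha> / 16 * ?T * (gap t + \<epsilon> t * (norm (x t - xt t))\<^sup>2 + (norm (v t))\<^sup>2)"
      by (simp add: algebra_simps)
    also have "\<dots> \<le> dissipation t" by (rule dissipation_terms) (use t elim in auto)
    finally show ?case by (simp add: \<mu>_def k_def mult.assoc)
  qed
  moreover have "\<mu> > 0" using K1 alpha_pos by (simp add: \<mu>_def)
  ultimately show ?thesis by (rule that[rotated])
qed

lemma rate_deriv: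
  assumes t: "t \<ge> t0"
  shows "(rate has_real_derivative
      \<epsilon>' t * t powr (2 * q + r - 1) + \<epsilon> t * ((2 * q + r - 1) * t powr (2 * q + r - 1) / t)
      + (2 * r - 2) * t powr (2 * r - 2) / t) (at t within {t0..})"
proof -
  have tp: "t > 0" using t t0_pos by simp
  have P: "((\<lambda>t. t powr p) has_real_derivative p * t powr p / t) (at t within {t0..})" for p
    using tp by (auto intro!: derivative_eq_intros simp: powr_diff)
  show ?thesis unfolding rate_def
    by (rule DERIV_cong[OF DERIV_add[OF DERIV_mult[OF eps_deriv[OF t] P] P]]) simp
qed

text \<open>Wherever \<open>energy\<close> exceeds \<open>M * rate\<close>, the dissipation is at
  least \<open>\<mu> * M * source\<close>. One half of this absorbs \<open>C * source\<close>, the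
  other half absorbs the decrease of the barrier, which is at most \<open>L / t * rate t\<close>
  relative to \<open>M\<close> and so eventually small compared with
  \<open>t powr (- r) * rate t\<close>.\<close>

lemma energy_rate:
  obtains M where "M > 0" "\<forall>\<^sub>F t in at_top. energy t \<le> M * rate t"
proof -
  obtain C where C: "C > 0" and eC: "\<forall>\<^sub>F s in at_top. dini_le energy s (C * source s - dissipation s)"
    using energy_dissipation by blast
  obtain \<mu> where \<mu>: "\<mu> > 0" and e\<mu>: "\<forall>\<^sub>F t in at_top. \<mu> * t powr (- r) * energy t \<le> dissipation t"
    using energy_le_dissipation by blast
  obtain K where K: "K > 0" and eK: "\<forall>\<^sub>F t in at_top. - \<epsilon>' t \<le> K * \<epsilon> t / t"
    using C1_C3_constants by blast
  define p where "p = 2 * q + r - 1"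
  \<comment> \<open>\<open>- L / t\<close> bounds the logarithmic derivative of \<open>rate\<close>
    from below: \<open>K\<close> accounts for \<epsilon>, \<open>\<bar>p\<bar>\<close> for the power
    next to it, 2 for the exponent \<open>2 * r - 2\<close>.\<close>
  define L where "L = K + \<bar>p\<bar> + 2"
  have L: "L > 0" using K by (simp add: L_def)
  have eL: "\<forall>\<^sub>F t in at_top. L / t \<le> \<mu> / 2 * t powr (- r)"
    using L \<mu> r_bounds by real_asymp
  have "\<forall>\<^sub>F t in at_top. dini_le energy t (C * source t - dissipation t)
      \<and> \<mu> * t powr (- r) * energy t \<le> dissipation t \<and> - \<epsilon>' t \<le> K * \<epsilon> t / t
      \<and> L / t \<le> \<mu> / 2 * t powr (- r) \<and> max t0 1 \<le> t"
    by (intro eventually_conj eC e\<mu> eK eL eventually_ge_at_top)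
  then obtain T where T: "\<And>t. t \<ge> T \<Longrightarrow> dini_le energy t (C * source t - dissipation t)
      \<and> \<mu> * t powr (- r) * energy t \<le> dissipation t \<and> - \<epsilon>' t \<le> K * \<epsilon> t / t
      \<and> L / t \<le> \<mu> / 2 * t powr (- r) \<and> max t0 1 \<le> t"
    unfolding eventually_at_top_linorder by blast
  have T0: "T \<ge> t0" "T \<ge> 1" using T[of T] by auto
  \<comment> \<open>The first entry lets half of the dissipation absorb the source; the second puts
    the energy below the barrier at the starting time \<open>T\<close>.\<close>
  define M where "M = max (2 * C / \<mu>) (energy T / rate T)"
  have M2: "2 * C / \<mu> \<le> M" "energy T / rate T \<le> M" by (auto simp: M_def)
  have "0 < 2 * C / \<mu>" using C \<mu> by simp
  then have "M > 0" using M2(1) by linarith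
  with M2 have M: "M > 0" "2 * C \<le> \<mu> * M" "energy T \<le> M * rate T"
    using \<mu> rate_pos[OF T0(1)] by (auto simp: pos_divide_le_eq mult.commute)
  have "energy t \<le> M * rate t" if t: "t \<ge> T" for t
  proof -
    have "energy t + - M * rate t \<le> 0"
    proof (rule dini_barrier[OF t, where f = "\<lambda>t. energy t + - M * rate t"])
      have "continuous_on {T..t} rate" using rate_deriv T0
        by (auto simp: continuous_on_eq_continuous_within intro!: DERIV_continuous DERIV_subset[OF rate_deriv])
      then show "continuous_on {T..t} (\<lambda>t. energy t + - M * rate t)"
        by (intro continuous_intros continuous_on_subset[OF energy_continuous]) (use T0 in auto)
      show "energy T + - M * rate T \<le> 0" using M by simp
    next
      fix s assume s: "T \<le> s" and gt: "energy s + - M * rate s > 0"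
      have s0: "s \<ge> t0" "s \<ge> 1" "s > 0" using T0 s by auto
      define d where "d = \<epsilon>' s * s powr p + \<epsilon> s * (p * s powr p / s) + (2 * r - 2) * s powr (2 * r - 2) / s"
      have "((\<lambda>t. - M * rate t) has_real_derivative - M * d) (at s within {t0..})"
        using DERIV_cmult[OF rate_deriv[OF s0(1)], of "- M"] by (simp add: d_def p_def)
      then have "((\<lambda>t. - M * rate t) has_real_derivative - M * d) (at_right s)"
        by (rule DERIV_subset) (use s0 in auto)
      with T[OF s] have "dini_le (\<lambda>t. energy t + - M * rate t) s (C * source s - dissipation s + - M * d)"
        by (intro dini_le_add) auto
      then show "dini_le (\<lambda>t. energy t + - M * rate t) s 0"
      proof (rule dini_le_mono)
        have "- d \<le> L / s * rate s"
        proof -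
          have i1: "- \<epsilon>' s * s powr p \<le> K * \<epsilon> s / s * s powr p" using T[OF s] by (intro mult_right_mono) auto
          have i2: "- p * (\<epsilon> s * s powr p / s) \<le> \<bar>p\<bar> * (\<epsilon> s * s powr p / s)"
            using eps_pos[OF s0(1)] s0 by (intro mult_right_mono) auto
          have i3: "- (2 * r - 2) * (s powr (2 * r - 2) / s) \<le> L * (s powr (2 * r - 2) / s)"
            using s0 K r_bounds q_pos by (intro mult_right_mono) (auto simp: L_def)
          have d: "- d = - \<epsilon>' s * s powr p + - p * (\<epsilon> s * s powr p / s) + - (2 * r - 2) * (s powr (2 * r - 2) / s)"
            unfolding d_def using s0(3) by (simp add: field_simps)
          have "- d \<le> K * \<epsilon> s / s * s powr p + \<bar>p\<bar> * (\<epsilon> s * s powr p / s) + L * (s powr (2 * r - 2) / s)"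
            unfolding d by (intro add_mono i1 i2 i3)
          also have "K * \<epsilon> s / s * s powr p + \<bar>p\<bar> * (\<epsilon> s * s powr p / s) = (K + \<bar>p\<bar>) * (\<epsilon> s * s powr p / s)"
            by (simp add: distrib_right add_divide_distrib)
          also have "\<dots> \<le> L * (\<epsilon> s * s powr p / s)"
            using eps_pos[OF s0(1)] s0 by (intro mult_right_mono) (auto simp: L_def)
          also have "L * (\<epsilon> s * s powr p / s) + L * (s powr (2 * r - 2) / s) = L / s * rate s"
            unfolding rate_def p_def by (simp add: algebra_simps add_divide_distrib)
          finally show ?thesis by simp
        qed
        also have "\<dots> \<le> \<mu> / 2 * s powr (- r) * rate s"
          using T[OF s] rate_pos[OF s0(1)] by (intro mult_right_mono) auto
        finally have "M * (- d) \<le> M * (\<mu> / 2 * s powr (- r) * rate s)" using M by (intro mult_left_mono) auto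
        also have "\<dots> = \<mu> * M / 2 * (s powr (- r) * rate s)" by simp
        also have sr: "s powr (- r) * rate s = source s" using s0 by (simp add: rate_eq powr_minus)
        finally have h1: "M * (- d) \<le> \<mu> * M / 2 * source s" .
        have "\<mu> * M * source s = \<mu> * s powr (- r) * (M * rate s)" unfolding sr[symmetric] by simp
        also have "\<dots> \<le> \<mu> * s powr (- r) * energy s"
          using gt \<mu> by (intro mult_left_mono) auto
        also have "\<dots> \<le> dissipation s" using T[OF s] by simp
        finally have h2: "\<mu> * M * source s \<le> dissipation s" .
        have "2 * C * source s \<le> \<mu> * M * source s"
          using M source_pos[OF s0(1)] by (intro mult_right_mono) auto
        moreover have "\<mu> * M / 2 * source s = (\<mu> * M * source s) / 2" "2 * C * source s = 2 * (C * source s)"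
          by simp_all
        ultimately have "C * source s - dissipation s + M * (- d) \<le> 0" using h1 h2 by linarith
        then show "C * source s - dissipation s + - M * d \<le> 0" by simp
      qed
    qed
    then show ?thesis by simp
  qed
  then have "\<forall>\<^sub>F t in at_top. energy t \<le> M * rate t" by (auto simp: eventually_at_top_linorder)
  with M(1) show ?thesis by (rule that)
qed

lemma rate_bounds:
  obtains M where "M > 0"
    "\<forall>\<^sub>F t in at_top. gap t \<le> M * (t powr (2 * r - 2 * q - 2) + \<epsilon> t * t powr (r - 1))"
    "\<forall>\<^sub>F t in at_top. (norm (v t))\<^sup>2 \<le> M * (t powr (2 * r - 2 * q - 2) + \<epsilon> t * t powr (r - 1))"
    "\<forall>\<^sub>F t in at_top. (norm (x t - xt t))\<^sup>2 \<le> M * rate t"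
proof -
  obtain M where M: "M > 0" and eM: "\<forall>\<^sub>F t in at_top. energy t \<le> M * rate t" using energy_rate by blast
  define M' where "M' = max (16 / 3 * M) (M * (32 / (3 * \<alpha>\<^sup>2)))"
  have M': "M' > 0" "16 / 3 * M \<le> M'" "M * (32 / (3 * \<alpha>\<^sup>2)) \<le> M'" using M by (auto simp: M'_def less_max_iff_disj)
  have ev: "\<forall>\<^sub>F t in at_top. energy t \<le> M * rate t \<and> t \<ge> max t0 1"
    by (intro eventually_conj eM eventually_ge_at_top)
  have T: "w \<le> M' * (t powr (2 * r - 2 * q - 2) + \<epsilon> t * t powr (r - 1))"
    if "(t powr q)\<^sup>2 * w \<le> 16 / 3 * energy t" "energy t \<le> M * rate t" "t \<ge> max t0 1" for t w
  proof -
    have t: "t \<ge> t0" "t > 0" using that by auto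
    have "(t powr q)\<^sup>2 * w \<le> (16 / 3 * M) * rate t" using that by linarith
    also have "\<dots> \<le> M' * rate t" using M' rate_pos[OF t(1)] by (intro mult_right_mono) auto
    finally have "w \<le> M' * rate t / (t powr q)\<^sup>2" using t by (simp add: field_simps)
    then show ?thesis using rate_div[OF t(2)] by (simp flip: times_divide_eq_right)
  qed
  show ?thesis
  proof (rule that[OF M'(1)])
    show "\<forall>\<^sub>F t in at_top. gap t \<le> M' * (t powr (2 * r - 2 * q - 2) + \<epsilon> t * t powr (r - 1))"
      using ev
    proof eventually_elim
      case (elim t)
      then show ?case using energy_lower_bounds(1)[of t] energy_nonneg[of t] by (intro T) auto
    qed
    show "\<forall>\<^sub>F t in at_top. (norm (v t))\<^sup>2 \<le> M' * (t powr (2 * r - 2 * q - 2) + \<epsilon> t * t powr (r - 1))"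
      using ev
    proof eventually_elim
      case (elim t)
      then show ?case using energy_lower_bounds(3)[of t] by (intro T) auto
    qed
    show "\<forall>\<^sub>F t in at_top. (norm (x t - xt t))\<^sup>2 \<le> M' * rate t"
      using ev
    proof eventually_elim
      case (elim t)
      then have t: "t \<ge> t0" by auto
      have "3 * \<alpha>\<^sup>2 / 32 * (norm (x t - xt t))\<^sup>2 \<le> M * rate t" using energy_lower_bounds(2)[OF t] elim by linarith
      then have "(norm (x t - xt t))\<^sup>2 \<le> M * (32 / (3 * \<alpha>\<^sup>2)) * rate t" using alpha_pos by (simp add: field_simps)
      also have "\<dots> \<le> M' * rate t" using M' rate_pos[OF t] by (intro mult_right_mono) auto
      finally show ?case .
    qed
  qed
qed

section \<open>Strong convergence\<close>

lemma xt_tendsto: "(xt \<longlongrightarrow> min_norm_element (argmin_set g)) at_top"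
proof -
  have "\<forall>\<^sub>F t in at_top. \<epsilon> t > 0"
    using eventually_ge_at_top[of t0] by (rule eventually_mono) (rule eps_pos)
  then have "filterlim \<epsilon> (at_right 0) at_top" using eps_lim by (simp add: filterlim_at eventually_mono)
  from filterlim_compose[OF x_min_tendsto_min_norm this] show ?thesis by (simp add: xt_def[abs_def])
qed

text \<open>\<open>rate\<close> need not tend to 0 when \<epsilon> decays slowly. A large \<epsilon>
  helps in another way: the gap controls \<open>y t - xt t\<close> with weight \<epsilon>, and
  \<open>x t - y t = - (b t *\<^sub>R v t)\<close> is small because \<open>b\<close> is
  bounded.\<close>

lemma strong_convergence_bound:
  obtains M where "M > 0" "\<forall>\<^sub>F t in at_top. (norm (x t - xt t))\<^sup>2 \<le> M * (t powr (r - 1) + t powr (2 * r - 2))"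
proof -
  obtain M where M: "M > 0"
    "\<forall>\<^sub>F t in at_top. gap t \<le> M * (t powr (2 * r - 2 * q - 2) + \<epsilon> t * t powr (r - 1))"
    "\<forall>\<^sub>F t in at_top. (norm (v t))\<^sup>2 \<le> M * (t powr (2 * r - 2 * q - 2) + \<epsilon> t * t powr (r - 1))"
    "\<forall>\<^sub>F t in at_top. (norm (x t - xt t))\<^sup>2 \<le> M * rate t"
    using rate_bounds by blast
  define B where "B = \<bar>\<gamma>\<bar> + 1"
  define M' where "M' = M + (4 * M + 2 * B\<^sup>2 * M)"
  have b: "\<forall>\<^sub>F t in at_top. b t < B" by (rule order_tendstoD(2)[OF b_lim]) (simp add: B_def)
  have e: "\<forall>\<^sub>F t in at_top. \<epsilon> t < 1" by (rule order_tendstoD(2)[OF eps_lim]) simp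
  have "\<forall>\<^sub>F t in at_top. (norm (x t - xt t))\<^sup>2 \<le> M' * (t powr (r - 1) + t powr (2 * r - 2))"
    using M(2-4) b b_eventually_pos e eventually_ge_at_top[of "max t0 1"]
  proof eventually_elim
    case (elim t)
    have t: "t \<ge> t0" "t \<ge> 1" "t > 0" using elim by auto
    have ep: "\<epsilon> t > 0" using eps_pos[OF t(1)] .
    let ?s = "t powr (r - 1) + t powr (2 * r - 2)"
    have "(norm (x t - xt t))\<^sup>2 \<le> M * ?s \<or> (norm (x t - xt t))\<^sup>2 \<le> (4 * M + 2 * B\<^sup>2 * M) * ?s"
    proof (cases "\<epsilon> t \<le> t powr (- 2 * q)")
      case True
      have "\<epsilon> t * t powr (2 * q + r - 1) \<le> t powr (- 2 * q) * t powr (2 * q + r - 1)"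
        by (intro mult_right_mono True) simp
      also have "\<dots> = t powr (r - 1)" using t by (simp add: powr_add[symmetric])
      finally have "M * rate t \<le> M * ?s" unfolding rate_def using M(1) by (intro mult_left_mono) auto
      then show ?thesis using elim(3) by linarith
    next
      case False
      let ?h = "t powr (2 * r - 2 * q - 2) + \<epsilon> t * t powr (r - 1)"
      \<comment> \<open>In this case \<open>t powr (- 2 * q)\<close> is below
        \<open>\<epsilon> t\<close>, so the whole bound carries a factor
        \<open>\<epsilon> t\<close>, which cancels against the weight in
        \<open>gap_growth\<close>.\<close>
      have h1: "?h \<le> \<epsilon> t * ?s"
      proof -
        have "t powr (2 * r - 2 * q - 2) = t powr (- 2 * q) * t powr (2 * r - 2)"
          using t by (simp add: powr_add[symmetric] algebra_simps)
        also have "\<dots> \<le> \<epsilon> t * t powr (2 * r - 2)" using False by (intro mult_right_mono) auto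
        finally show ?thesis by (simp add: distrib_left)
      qed
      have h2: "?h \<le> ?s"
      proof -
        have "\<epsilon> t * ?s \<le> 1 * ?s" using elim by (intro mult_right_mono) auto
        then show ?thesis using h1 by simp
      qed
      have "\<epsilon> t / 2 * (norm (y t - xt t))\<^sup>2 \<le> M * ?h" using gap_growth[OF t(1)] elim(1) by linarith
      also have "\<dots> \<le> M * (\<epsilon> t * ?s)" using M(1) by (intro mult_left_mono h1) auto
      also have "\<dots> = \<epsilon> t / 2 * (2 * M * ?s)" by simp
      finally have y: "(norm (y t - xt t))\<^sup>2 \<le> 2 * M * ?s"
        using ep by (subst (asm) mult_le_cancel_left_pos) auto
      have "(b t)\<^sup>2 * (norm (v t))\<^sup>2 \<le> B\<^sup>2 * (M * ?s)"
      proof (intro mult_mono power_mono)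
        show "(norm (v t))\<^sup>2 \<le> M * ?s"
          using elim(2) mult_left_mono[OF h2, of M] M(1) by linarith
      qed (use elim in auto)
      moreover have xeq: "x t - xt t = (y t - xt t) + - (b t *\<^sub>R v t)" by (simp add: y_def)
      have "(norm (x t - xt t))\<^sup>2 \<le> 2 * (norm (y t - xt t))\<^sup>2 + 2 * ((b t)\<^sup>2 * (norm (v t))\<^sup>2)"
        unfolding xeq using norm_add_power2_le[of "y t - xt t" "- (b t *\<^sub>R v t)"]
        by (simp only: norm_minus_cancel norm_scaleR power_mult_distrib power2_abs)
      ultimately have "(norm (x t - xt t))\<^sup>2 \<le> 2 * (2 * M * ?s) + 2 * (B\<^sup>2 * (M * ?s))"
        using y by linarith
      also have "\<dots> = (4 * M + 2 * B\<^sup>2 * M) * ?s" by (simp add: algebra_simps)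
      finally show ?thesis by blast
    qed
    moreover have "0 \<le> M * ?s" "0 \<le> (4 * M + 2 * B\<^sup>2 * M) * ?s" using M(1) by auto
    moreover have "M' * ?s = M * ?s + (4 * M + 2 * B\<^sup>2 * M) * ?s" unfolding M'_def by (rule distrib_right)
    ultimately show ?case by linarith
  qed
  moreover have "M' > 0" using M(1) by (simp add: M'_def add_pos_nonneg)
  ultimately show ?thesis by (rule that[rotated])
qed

lemma x_tendsto: "(x \<longlongrightarrow> min_norm_element (argmin_set g)) at_top"
proof -
  obtain M where M: "\<forall>\<^sub>F t in at_top. (norm (x t - xt t))\<^sup>2 \<le> M * (t powr (r - 1) + t powr (2 * r - 2))"
    using strong_convergence_bound by blast
  have "((\<lambda>t. M * (t powr (r - 1) + t powr (2 * r - 2))) \<longlongrightarrow> 0) at_top"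
    using r_bounds by real_asymp
  then have "((\<lambda>t. (norm (x t - xt t))\<^sup>2) \<longlongrightarrow> 0) at_top"
    by (rule Lim_null_comparison[rotated]) (use M in simp)
  from tendsto_real_sqrt[OF this] have "((\<lambda>t. x t - xt t) \<longlongrightarrow> 0) at_top"
    by (simp add: tendsto_norm_zero_iff)
  from tendsto_add[OF this xt_tendsto] show ?thesis by simp
qed

section \<open>The rates in Landau notation\<close>

lemma argmin_INF:
  assumes "z \<in> argmin_set g" shows "(INF z. g z) = g z"
  using assms by (intro cInf_eq_minimum) (auto simp: argmin_set_def)

lemma x_bounds:
  shows gap_bigo: "gap \<in> O(\<lambda>t. t powr (2 * r - 2 * q - 2) + \<epsilon> t * t powr (r - 1))"
    and value_bigo: "(\<lambda>t. g (y t) - (INF z. g z)) \<in> O(\<lambda>t. t powr (2 * r - 2 * q - 2) + \<epsilon> t)"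
    and velocity_bigo: "(\<lambda>t. norm (v t)) \<in> O(\<lambda>t. t powr (r - q - 1) + sqrt (\<epsilon> t) * t powr ((r - 1) / 2))"
    and distance_bigo: "(\<lambda>t. norm (x t - xt t))
      \<in> O(\<lambda>t. t powr (r - 1) + sqrt (\<epsilon> t) * t powr ((2 * q + r - 1) / 2))"
proof -
  obtain M where M: "M > 0"
    "\<forall>\<^sub>F t in at_top. gap t \<le> M * (t powr (2 * r - 2 * q - 2) + \<epsilon> t * t powr (r - 1))"
    "\<forall>\<^sub>F t in at_top. (norm (v t))\<^sup>2 \<le> M * (t powr (2 * r - 2 * q - 2) + \<epsilon> t * t powr (r - 1))"
    "\<forall>\<^sub>F t in at_top. (norm (x t - xt t))\<^sup>2 \<le> M * rate t"
    using rate_bounds by blast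
  note large = eventually_ge_at_top[of "max t0 1"]
  show "gap \<in> O(\<lambda>t. t powr (2 * r - 2 * q - 2) + \<epsilon> t * t powr (r - 1))"
  proof (rule bigoI[where c = M])
    show "\<forall>\<^sub>F t in at_top. norm (gap t) \<le> M * norm (t powr (2 * r - 2 * q - 2) + \<epsilon> t * t powr (r - 1))"
      using M(2) large
    proof eventually_elim
      case (elim t)
      then have "0 \<le> t powr (2 * r - 2 * q - 2) + \<epsilon> t * t powr (r - 1)" using eps_nonneg[of t] by simp
      then show ?case using elim gap_nonneg[of t] by simp
    qed
  qed
  show "(\<lambda>t. g (y t) - (INF z. g z)) \<in> O(\<lambda>t. t powr (2 * r - 2 * q - 2) + \<epsilon> t)"
  proof (rule bigoI[where c = "M + X\<^sup>2 / 2"])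
    let ?z = "min_norm_element (argmin_set g)"
    show "\<forall>\<^sub>F t in at_top. norm (g (y t) - (INF z. g z)) \<le> (M + X\<^sup>2 / 2) * norm (t powr (2 * r - 2 * q - 2) + \<epsilon> t)"
      using M(2) large
    proof eventually_elim
      case (elim t)
      then have t: "t \<ge> t0" "t \<ge> 1" by auto
      have e: "\<epsilon> t > 0" using eps_pos[OF t(1)] .
      have "g ?z \<le> g (y t)" using min_norm_element_argmin by (simp add: argmin_set_def)
      \<comment> \<open>Comparing \<open>xt t\<close> with the minimum-norm minimizer costs at most
        \<open>\<epsilon> t / 2 * X\<^sup>2\<close>; this is why the rate for \<open>g\<close>
        contains \<epsilon> without a decaying factor.\<close>
      have "tikhonov g (\<epsilon> t) (xt t) \<le> tikhonov g (\<epsilon> t) ?z" unfolding xt_def by (rule x_min_le[OF e])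
      then have "g (y t) - g ?z \<le> gap t + \<epsilon> t / 2 * X\<^sup>2 - \<epsilon> t / 2 * (norm (y t))\<^sup>2"
        unfolding gap_def tikhonov_def X_def by simp
      moreover have "0 \<le> \<epsilon> t / 2 * (norm (y t))\<^sup>2" using e by simp
      ultimately have "g (y t) - g ?z \<le> M * (t powr (2 * r - 2 * q - 2) + \<epsilon> t * t powr (r - 1)) + X\<^sup>2 / 2 * \<epsilon> t"
        using elim(1) by (simp add: mult.commute)
      also have "\<dots> \<le> M * (t powr (2 * r - 2 * q - 2) + \<epsilon> t * 1) + X\<^sup>2 / 2 * (t powr (2 * r - 2 * q - 2) + \<epsilon> t)"
      proof (intro add_mono mult_left_mono)
        have "t powr (r - 1) \<le> t powr 0" using t r_bounds by (intro powr_mono) auto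
        then show "t powr (r - 1) \<le> 1" using t by simp
      qed (use M e in auto)
      also have "\<dots> = (M + X\<^sup>2 / 2) * (t powr (2 * r - 2 * q - 2) + \<epsilon> t)" by (simp add: algebra_simps)
      finally show ?case
        using \<open>g ?z \<le> g (y t)\<close> e unfolding argmin_INF[OF min_norm_element_argmin] by simp
    qed
  qed
  \<comment> \<open>The energy bounds squares. A sum of squares of nonnegative numbers is at most
    the square of their sum, so roots can be taken term by term.\<close>
  have sq: "w \<le> sqrt M * (u1 + u2)" if "w\<^sup>2 \<le> M * (u1\<^sup>2 + u2\<^sup>2)" "0 \<le> u1" "0 \<le> u2" for w u1 u2 :: real
  proof (rule power2_le_imp_le)
    have "w\<^sup>2 \<le> M * (u1\<^sup>2 + u2\<^sup>2)" by fact
    also have "\<dots> \<le> M * (u1 + u2)\<^sup>2" using M(1) that by (intro mult_left_mono) (auto simp: power2_sum)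
    also have "\<dots> = (sqrt M * (u1 + u2))\<^sup>2" using M(1) by (simp add: power_mult_distrib)
    finally show "w\<^sup>2 \<le> (sqrt M * (u1 + u2))\<^sup>2" .
  qed (use M that in auto)
  show "(\<lambda>t. norm (v t)) \<in> O(\<lambda>t. t powr (r - q - 1) + sqrt (\<epsilon> t) * t powr ((r - 1) / 2))"
  proof (rule bigoI[where c = "sqrt M"])
    show "\<forall>\<^sub>F t in at_top. norm (norm (v t)) \<le> sqrt M * norm (t powr (r - q - 1) + sqrt (\<epsilon> t) * t powr ((r - 1) / 2))"
      using M(3) large
    proof eventually_elim
      case (elim t)
      then have t: "t \<ge> t0" "t > 0" by auto
      have "(t powr (r - q - 1))\<^sup>2 = t powr (2 * r - 2 * q - 2)" "(t powr ((r - 1) / 2))\<^sup>2 = t powr (r - 1)"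
        using t by (simp_all add: power2_eq_square powr_add[symmetric]) (simp add: algebra_simps)
      then have "(norm (v t))\<^sup>2 \<le> M * ((t powr (r - q - 1))\<^sup>2 + (sqrt (\<epsilon> t) * t powr ((r - 1) / 2))\<^sup>2)"
        using elim(1) eps_nonneg[OF t(1)] by (simp add: power_mult_distrib)
      from sq[OF this] show ?case using eps_nonneg[OF t(1)] by simp
    qed
  qed
  show "(\<lambda>t. norm (x t - xt t)) \<in> O(\<lambda>t. t powr (r - 1) + sqrt (\<epsilon> t) * t powr ((2 * q + r - 1) / 2))"
  proof (rule bigoI[where c = "sqrt M"])
    show "\<forall>\<^sub>F t in at_top. norm (norm (x t - xt t)) \<le> sqrt M * norm (t powr (r - 1) + sqrt (\<epsilon> t) * t powr ((2 * q + r - 1) / 2))"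
      using M(4) large
    proof eventually_elim
      case (elim t)
      then have t: "t \<ge> t0" "t > 0" by auto
      have "(t powr (r - 1))\<^sup>2 = t powr (2 * r - 2)" "(t powr ((2 * q + r - 1) / 2))\<^sup>2 = t powr (2 * q + r - 1)"
        using t by (simp_all add: power2_eq_square powr_add[symmetric])
      then have "(norm (x t - xt t))\<^sup>2 \<le> M * ((t powr (r - 1))\<^sup>2 + (sqrt (\<epsilon> t) * t powr ((2 * q + r - 1) / 2))\<^sup>2)"
        using elim(1) eps_nonneg[OF t(1)] by (simp add: power_mult_distrib rate_def add.commute)
      from sq[OF this] show ?case using eps_nonneg[OF t(1)] by simp
    qed
  qed
qed

section \<open>Integral estimates\<close>

lemma dissipation_integrable:
  assumes "set_integrable lborel {t0..} (\<lambda>t. t powr (2 * q - 1) * \<epsilon> t)"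
  obtains T where "T \<ge> t0" "T \<ge> 1" "\<And>t. t \<ge> T \<Longrightarrow> b t > 0" "set_integrable lborel {T..} dissipation"
proof -
  obtain C where C: "C > 0" and eC: "\<forall>\<^sub>F s in at_top. dini_le energy s (C * source s - dissipation s)"
    using energy_dissipation by blast
  have "\<forall>\<^sub>F t in at_top. dini_le energy t (C * source t - dissipation t) \<and> b t > 0 \<and> max t0 1 \<le> t"
    by (intro eventually_conj eC b_eventually_pos eventually_ge_at_top)
  then obtain T where T: "\<And>t. t \<ge> T \<Longrightarrow> dini_le energy t (C * source t - dissipation t) \<and> b t > 0 \<and> max t0 1 \<le> t"
    unfolding eventually_at_top_linorder by blast
  have T0: "T \<ge> t0" "T \<ge> 1" using T[of T] by auto
  have sub: "{T..} \<subseteq> {t0..}" using T0 by auto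
  have "set_integrable lborel {T..} (\<lambda>t. t powr (2 * q - 1) * \<epsilon> t)"
    using assms by (rule set_integrable_subset) (use sub in auto)
  \<comment> \<open>The exponent is less than -1 because \<open>r < 1\<close>; the other summand of
    \<open>source\<close> is integrable by assumption.\<close>
  moreover have "set_integrable lborel {T..} (\<lambda>t. t powr (r - 2))"
    using T0 r_bounds by (intro set_integrable_powr) auto
  ultimately have "set_integrable lborel {T..} (\<lambda>t. C * (t powr (2 * q - 1) * \<epsilon> t + t powr (r - 2)))"
    by (intro set_integrable_mult_right set_integral_add(1)) auto
  then have "set_integrable lborel {T..} (\<lambda>t. C * source t)" by (simp add: source_def mult.commute)
  then have "set_integrable lborel {T..} dissipation"
  proof (rule set_integrable_dissipation[rotated 6])
    show "continuous_on {T..} energy" "continuous_on {T..} dissipation" "continuous_on {T..} (\<lambda>t. C * source t)"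
      by (intro continuous_intros continuous_on_subset[OF energy_continuous sub]
          continuous_on_subset[OF dissipation_continuous sub] continuous_on_subset[OF source_continuous sub])+
  qed (use T T0 energy_nonneg dissipation_terms(5) source_pos C in \<open>auto intro!: less_imp_le[OF mult_pos_pos]\<close>)
  with T0 T show ?thesis by (intro that[of T]) auto
qed

text \<open>The terms of \<open>dissipation\<close> dominate the integrands. The weight of
  \<open>A\<close> depends on \<gamma>: \<open>b t\<close> is eventually above \<gamma>/2 if
  \<gamma> > 0, whereas \<gamma> = 0 gives
  \<open>b t * (t powr q)\<^sup>2 = \<beta> * t powr q\<close>, with one factor
  \<open>t powr q\<close> lost.\<close>

lemma integral_estimates:
  assumes int: "set_integrable lborel {t0..} (\<lambda>t. t powr (2 * q - 1) * \<epsilon> t)"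
  shows gap_integrable: "set_integrable lborel {t0..} (\<lambda>t. t powr q * gap t)"
    and velocity_integrable: "set_integrable lborel {t0..} (\<lambda>t. t powr q * (norm (v t))\<^sup>2)"
    and A_integrable: "\<gamma> > 0 \<Longrightarrow> set_integrable lborel {t0..} (\<lambda>t. t powr (2 * q) * (norm (A t))\<^sup>2)"
    and gradient_integrable: "\<gamma> = 0 \<Longrightarrow> set_integrable lborel {t0..} (\<lambda>t. t powr (2 * q - 1) * (norm (G (y t)))\<^sup>2)"
proof -
  obtain T where T: "T \<ge> t0" "T \<ge> 1" "\<And>t. t \<ge> T \<Longrightarrow> b t > 0" "set_integrable lborel {T..} dissipation"
    using dissipation_integrable[OF int] by blast
  have cd: "set_integrable lborel {T'..} (\<lambda>t. c * dissipation t)" if "T' \<ge> T" for c T'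
    by (intro set_integrable_mult_right set_integrable_subset[OF T(4)]) (use that in auto)
  show "set_integrable lborel {t0..} (\<lambda>t. t powr q * gap t)"
  proof (rule set_integrable_continuous_bound[OF T(1) _ _ cd[OF order_refl, of "8 / \<alpha>"]])
    show "continuous_on {t0..} (\<lambda>t. t powr q * gap t)"
      by (intro continuous_on_mult powr_continuous gap_continuous)
    fix t assume t: "t \<ge> T"
    then have "\<alpha> / 8 * t powr q * gap t \<le> dissipation t" "0 \<le> t powr q * gap t"
      using dissipation_terms(1)[of t] gap_nonneg[of t] T by auto
    then show "\<bar>t powr q * gap t\<bar> \<le> 8 / \<alpha> * dissipation t" using alpha_pos by (simp add: field_simps)
  qed
  show "set_integrable lborel {t0..} (\<lambda>t. t powr q * (norm (v t))\<^sup>2)"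
  proof (rule set_integrable_continuous_bound[OF T(1) _ _ cd[OF order_refl, of "16 / \<alpha>"]])
    show "continuous_on {t0..} (\<lambda>t. t powr q * (norm (v t))\<^sup>2)"
      by (intro continuous_on_mult powr_continuous continuous_on_power continuous_on_norm v_continuous)
    fix t assume t: "t \<ge> T"
    then have "\<alpha> / 16 * t powr q * (norm (v t))\<^sup>2 \<le> dissipation t" "0 \<le> t powr q * (norm (v t))\<^sup>2"
      using dissipation_terms(2)[of t] T by auto
    then show "\<bar>t powr q * (norm (v t))\<^sup>2\<bar> \<le> 16 / \<alpha> * dissipation t" using alpha_pos by (simp add: field_simps)
  qed
  show "set_integrable lborel {t0..} (\<lambda>t. t powr (2 * q) * (norm (A t))\<^sup>2)" if g: "\<gamma> > 0"
  proof -
    have "\<forall>\<^sub>F t in at_top. b t > \<gamma> / 2" by (rule order_tendstoD(1)[OF b_lim]) (use g in simp)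
    then obtain T1 where T1: "\<And>t. t \<ge> T1 \<Longrightarrow> b t > \<gamma> / 2" unfolding eventually_at_top_linorder by blast
    show ?thesis
    proof (rule set_integrable_continuous_bound[where T = "max T T1" and h = "\<lambda>t. 4 / \<gamma> * dissipation t"])
      show "t0 \<le> max T T1" using T by auto
      show "set_integrable lborel {max T T1..} (\<lambda>t. 4 / \<gamma> * dissipation t)" by (rule cd) simp
      show "continuous_on {t0..} (\<lambda>t. t powr (2 * q) * (norm (A t))\<^sup>2)"
        by (intro continuous_on_mult powr_continuous continuous_on_power continuous_on_norm A_continuous)
      fix t assume t: "t \<ge> max T T1"
      then have t': "t \<ge> t0" "t > 0" "b t > 0" "b t > \<gamma> / 2" using T T1 by auto
      have "t powr (2 * q) = (t powr q)\<^sup>2" using t' by (simp add: power2_eq_square powr_add[symmetric])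
      moreover have "\<gamma> / 4 * ((t powr q)\<^sup>2 * (norm (A t))\<^sup>2) \<le> b t / 2 * ((t powr q)\<^sup>2 * (norm (A t))\<^sup>2)"
        using t' by (intro mult_right_mono) auto
      ultimately have "\<gamma> / 4 * (t powr (2 * q) * (norm (A t))\<^sup>2) \<le> dissipation t"
        using dissipation_terms(3)[OF t'(1,3)] by (simp add: mult.assoc)
      then show "\<bar>t powr (2 * q) * (norm (A t))\<^sup>2\<bar> \<le> 4 / \<gamma> * dissipation t" using g by (simp add: field_simps)
    qed
  qed
  show "set_integrable lborel {t0..} (\<lambda>t. t powr (2 * q - 1) * (norm (G (y t)))\<^sup>2)" if g: "\<gamma> = 0"
  proof -
    have \<beta>: "\<beta> > 0" using g gamma_beta by simp
    \<comment> \<open>\<open>G (y t)\<close> differs from \<open>A t\<close> by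
      \<open>\<epsilon> t *\<^sub>R x t\<close>; the convergence already proved bounds
      \<open>x\<close>.\<close>
    have "((\<lambda>t. norm (x t)) \<longlongrightarrow> X) at_top" unfolding X_def by (rule tendsto_norm[OF x_tendsto])
    then have "\<forall>\<^sub>F t in at_top. norm (x t) < X + 1" by (rule order_tendstoD(2)) simp
    then obtain T1 where T1: "\<And>t. t \<ge> T1 \<Longrightarrow> norm (x t) < X + 1" unfolding eventually_at_top_linorder by blast
    \<comment> \<open>Estimating \<open>(\<epsilon> t)\<^sup>2\<close> by
      \<open>\<epsilon> t0 * \<epsilon> t\<close> lets the assumption \<open>int\<close> cover the
      penalty term; in the other term \<open>t powr (2 * q - 1)\<close> is at most
      \<open>t powr q\<close>.\<close>
    let ?h = "\<lambda>t. 4 / \<beta> * dissipation t + 2 * \<epsilon> t0 * (X + 1)\<^sup>2 * (t powr (2 * q - 1) * \<epsilon> t)"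
    show ?thesis
    proof (rule set_integrable_continuous_bound[where T = "max T T1" and h = ?h])
      show "t0 \<le> max T T1" using T by auto
      have "set_integrable lborel {max T T1..} (\<lambda>t. t powr (2 * q - 1) * \<epsilon> t)"
        using int by (rule set_integrable_subset) (use T in auto)
      then show "set_integrable lborel {max T T1..} ?h"
        by (intro set_integral_add(1) cd set_integrable_mult_right) auto
      show "continuous_on {t0..} (\<lambda>t. t powr (2 * q - 1) * (norm (G (y t)))\<^sup>2)"
        by (intro continuous_on_mult powr_continuous continuous_on_power continuous_on_norm
            continuous_on_compose2[OF G_continuous y_continuous]) auto
      fix t assume t: "t \<ge> max T T1"
      then have t': "t \<ge> t0" "t \<ge> 1" "b t > 0" "norm (x t) < X + 1" using T T1 by auto
      have e: "0 < \<epsilon> t" "\<epsilon> t \<le> \<epsilon> t0" using eps_pos eps_noninc t' by auto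
      have "G (y t) = A t + - (\<epsilon> t *\<^sub>R x t)" by (simp add: A_def)
      then have "(norm (G (y t)))\<^sup>2 \<le> 2 * (norm (A t))\<^sup>2 + 2 * ((\<epsilon> t)\<^sup>2 * (norm (x t))\<^sup>2)"
        using norm_add_power2_le[of "A t" "- (\<epsilon> t *\<^sub>R x t)"] by (simp add: power_mult_distrib)
      also have "(\<epsilon> t)\<^sup>2 * (norm (x t))\<^sup>2 \<le> (\<epsilon> t0 * \<epsilon> t) * (X + 1)\<^sup>2"
        unfolding power2_eq_square[of "\<epsilon> t"] using e t' by (intro mult_mono power_mono) auto
      finally have "t powr (2 * q - 1) * (norm (G (y t)))\<^sup>2
          \<le> t powr (2 * q - 1) * (2 * (norm (A t))\<^sup>2 + 2 * ((\<epsilon> t0 * \<epsilon> t) * (X + 1)\<^sup>2))"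
        by (intro mult_left_mono) auto
      also have "\<dots> = 2 * (t powr (2 * q - 1) * (norm (A t))\<^sup>2) + 2 * \<epsilon> t0 * (X + 1)\<^sup>2 * (t powr (2 * q - 1) * \<epsilon> t)"
        by (simp add: algebra_simps)
      also have "t powr (2 * q - 1) * (norm (A t))\<^sup>2 \<le> t powr q * (norm (A t))\<^sup>2"
        using t' q_less_1 by (intro mult_right_mono powr_mono) auto
      also have "t powr q * (norm (A t))\<^sup>2 \<le> 2 / \<beta> * dissipation t"
      proof -
        have "b t / 2 * (t powr q)\<^sup>2 = \<beta> / 2 * t powr q"
          using t' by (simp add: beta_coeff_def g power2_eq_square)
        then have "\<beta> / 2 * t powr q * (norm (A t))\<^sup>2 \<le> dissipation t"
          using dissipation_terms(3)[OF t'(1,3)] by simp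
        then show ?thesis using \<beta> by (simp add: field_simps)
      qed
      finally show "\<bar>t powr (2 * q - 1) * (norm (G (y t)))\<^sup>2\<bar> \<le> ?h t" by simp
    qed
  qed
qed

end

theorem theorem10:
  fixes g :: "'a::{real_inner, complete_space} \<Rightarrow> real"
    and grad_g :: "'a \<Rightarrow> 'a"
    and \<epsilon> \<epsilon>' :: "real \<Rightarrow> real"
    and t0 \<alpha> \<beta> \<gamma> q r :: real
    and u0 v0 :: 'a
    and x v :: "real \<Rightarrow> 'a"
  assumes g_convex: "convex_on UNIV g"
    and g_gradient: "\<And>z. GDERIV g z :> grad_g z"
    and grad_lipschitz: "\<And>S. bounded S \<Longrightarrow> \<exists>L. L-lipschitz_on S grad_g"
    and argmin_nonempty: "argmin_set g \<noteq> {}"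
    and t0_pos: "t0 > 0" and alpha_pos: "\<alpha> > 0" and q_pos: "0 < q" and q_less_1: "q < 1"
    and gamma_beta: "\<gamma> > 0 \<or> (\<gamma> = 0 \<and> \<beta> > 0)"
    and beta_neg: "\<beta> < 0 \<Longrightarrow> t0 > \<bar>\<beta> / \<gamma>\<bar> powr (1 / q)"
    and eps_nonneg: "\<And>t. t \<ge> t0 \<Longrightarrow> \<epsilon> t \<ge> 0"
    and eps_noninc: "\<And>s t. t0 \<le> s \<Longrightarrow> s \<le> t \<Longrightarrow> \<epsilon> t \<le> \<epsilon> s"
    and eps_deriv: "\<And>t. t \<ge> t0 \<Longrightarrow> (\<epsilon> has_real_derivative \<epsilon>' t) (at t within {t0..})"
    and eps_deriv_cont: "continuous_on {t0..} \<epsilon>'"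
    and eps_lim: "(\<epsilon> \<longlongrightarrow> 0) at_top"
    and r_bounds: "q < r" "r < 1"
    and C1: "\<exists>K1>0. \<forall>\<^sub>F t in at_top. \<epsilon> t \<ge> K1 / t powr (r + q)"
    and C2: "\<gamma> \<noteq> 0 \<Longrightarrow> \<forall>\<^sub>F t in at_top. \<epsilon> t \<le> \<alpha> / (2 * \<gamma> * t powr q)"
    and C3: "\<exists>K3>0. \<forall>\<^sub>F t in at_top. (\<epsilon>' t / \<epsilon> t)\<^sup>2 \<le> K3 / t\<^sup>2"
    and sol: "DS_solution grad_g \<epsilon> \<alpha> \<beta> \<gamma> q t0 u0 v0 x v"
  defines "y \<equiv> \<lambda>t. x t + beta_coeff \<gamma> \<beta> q t *\<^sub>R v t"
    and "gt \<equiv> \<lambda>t. tikhonov g (\<epsilon> t)"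
    and "xt \<equiv> \<lambda>t. the_minimizer (tikhonov g (\<epsilon> t))"
  shows "(x \<longlongrightarrow> min_norm_element (argmin_set g)) at_top
    \<and> ((\<lambda>t. gt t (y t) - gt t (xt t))
          \<in> O(\<lambda>t. t powr (2 * r - 2 * q - 2) + \<epsilon> t * t powr (r - 1))
       \<and> (\<lambda>t. g (y t) - (INF z. g z)) \<in> O(\<lambda>t. t powr (2 * r - 2 * q - 2) + \<epsilon> t)
       \<and> (\<lambda>t. norm (v t)) \<in> O(\<lambda>t. t powr (r - q - 1) + sqrt (\<epsilon> t) * t powr ((r - 1) / 2))
       \<and> (\<lambda>t. norm (x t - xt t))
          \<in> O(\<lambda>t. t powr (r - 1) + sqrt (\<epsilon> t) * t powr ((2 * q + r - 1) / 2)))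
    \<and> (set_integrable lborel {t0..} (\<lambda>t. t powr (2 * q - 1) * \<epsilon> t) \<longrightarrow>
         set_integrable lborel {t0..} (\<lambda>t. t powr q * (gt t (y t) - gt t (xt t)))
       \<and> set_integrable lborel {t0..} (\<lambda>t. t powr q * (norm (v t))\<^sup>2)
       \<and> (\<gamma> > 0 \<longrightarrow> set_integrable lborel {t0..}
              (\<lambda>t. t powr (2 * q) * (norm (grad_g (y t) + \<epsilon> t *\<^sub>R x t))\<^sup>2))
       \<and> (\<gamma> = 0 \<longrightarrow> set_integrable lborel {t0..}
              (\<lambda>t. t powr (2 * q - 1) * (norm (grad_g (y t)))\<^sup>2)))"
proof -
  \<comment> \<open>The acceleration, bound by an existential quantifier in
    \<open>DS_solution\<close>, becomes a parameter of the locale.\<close>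
  obtain a where a: "\<And>t. t \<ge> t0 \<Longrightarrow>
        (x has_vector_derivative v t) (at t within {t0..}) \<and>
        (v has_vector_derivative a t) (at t within {t0..}) \<and>
        a t + (\<alpha> / t powr q) *\<^sub>R v t + grad_g (x t + beta_coeff \<gamma> \<beta> q t *\<^sub>R v t) + \<epsilon> t *\<^sub>R x t = 0"
    using sol unfolding DS_solution_def by blast
  interpret D: tikhonov_dynamics g grad_g \<epsilon> \<epsilon>' t0 \<alpha> \<beta> \<gamma> q r x v a
  proof
    show "\<exists>L. L-lipschitz_on S grad_g" if "bounded S" for S using grad_lipschitz[OF that] .
  qed (use g_convex g_gradient argmin_nonempty t0_pos alpha_pos q_pos q_less_1 gamma_beta eps_nonneg
      eps_noninc eps_deriv eps_lim r_bounds C1 C2 C3 a in \<open>simp_all\<close>)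
  have y: "y = D.y" by (simp add: y_def D.y_def fun_eq_iff)
  have xt: "xt = D.xt" by (simp add: xt_def D.xt_def fun_eq_iff)
  have gap: "gt t (y t) - gt t (xt t) = D.gap t" for t by (simp add: gt_def y xt D.gap_def)
  have A: "grad_g (y t) + \<epsilon> t *\<^sub>R x t = D.A t" for t by (simp add: y D.A_def)
  show ?thesis
    unfolding gap A unfolding y xt
    using D.x_tendsto D.x_bounds D.integral_estimates by blast
qed

end
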